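(* Assume $\sigma^2$ is known, $p_n=n$, $\epsilon_1,\dots,\epsilon_n$ are i.i.d. $N(0,\sigma^2)$, and Assumption 1 holds. Fix $\alpha_1>1/2$ and let $\Theta_n=\mathfrak S_{(1^{-\alpha_1},2^{-\alpha_1},\dots,n^{-\alpha_1})^\top}$. Then $$\lim_{n\to\infty}\ \inf_{\hat{\mathbf f}}\ \sup_{\boldsymbol\theta\in\Theta_n}\frac{R_n(\hat{\mathbf f},\mathbf f)}{R_n(\mathbf w^*|\mathcal M_{AS},\mathbf f)}=\infty,$$ where $\mathbf f=\sqrt n\sum_{j=1}^n\theta_j\boldsymbol\phi_j$ and the infimum is over all measurable estimators $\hat{\mathbf f}=\hat{\mathbf f}(\mathbf y)$. Equivalently, for every estimator $\hat{\mathbf f}$ there exists (for each $n$) $\mathbf f$ with $\boldsymbol\theta\in\Theta_n$ such that $R_n(\hat{\mathbf f},\mathbf f)/R_n(\mathbf w^*|\mathcal M_{AS},\mathbf f)\to\infty$.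
   Context: Non-nested setup. We observe $\mathbf y=\mathbf f+\boldsymbol\epsilon\in\mathbb R^n$ with $\mathbf f=\mathbf X\boldsymbol\beta$, $\mathbf X\in\mathbb R^{n\times n}$ nonstochastic of full rank. Let $\{\boldsymbol\phi_1,\dots,\boldsymbol\phi_n\}$ be a given orthonormal basis of $\mathbb R^n$ (the column space of $\mathbf X$) and $\theta_j=\boldsymbol\phi_j^\top\mathbf f/\sqrt n$. Each subset $\mathcal I\subseteq\{1,\dots,n\}$ defines a candidate model with estimator $\hat{\mathbf f}_{\mathcal I}=\sum_{j\in\mathcal I}\boldsymbol\phi_j\boldsymbol\phi_j^\top\mathbf y$; $\mathcal M_{AS}=\{\mathcal I_1,\dots,\mathcal I_{2^n}\}$ is the set of all subsets. For $\mathbf w$ in the simplex $\mathcal W_{2^n}$, $R_n(\mathbf w|\mathcal M_{AS},\mathbf f)=n^{-1}\mathbb E\|\sum_mw_m\hat{\mathbf f}_{\mathcal I_m}-\mathbf f\|^2$ and $R_n(\mathbf w^*|\mathcal M_{AS},\mathbf f)=\min_{\mathbf w\in\mathcal W_{2^n}}R_n(\mathbf w|\mathcal M_{AS},\mathbf f)$. For any estimator, $R_n(\hat{\mathbf f},\mathbf f)=n^{-1}\mathbb E\|\hat{\mathbf f}-\mathbf f\|^2$. For a vector $\mathbf e$, $\mathfrak S_{\mathbf e}$ is the set of vectors whose entries are a permutation of the entries of $\mathbf e$. Assumption 1: $\limsup_n n^{-1}\|\mathbf f\|^2<\infty$. *)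

theory Defs
  imports "HOL-Probability.Probability"
begin

text \<open>Vectors of R^n are represented as functions nat => real, only indices < n matter.
  A family of orthonormal bases is phi n j i = i-th coordinate of the j-th basis vector
  (0-indexed, j, i < n).\<close>

definition sqnorm :: "nat \<Rightarrow> (nat \<Rightarrow> real) \<Rightarrow> real" where
  "sqnorm n v = (\<Sum>i<n. (v i)\<^sup>2)"

definition gauss_noise :: "nat \<Rightarrow> real \<Rightarrow> (nat \<Rightarrow> real) measure" where
  "gauss_noise n \<sigma> = PiM {..<n} (\<lambda>_. density lborel (normal_density 0 \<sigma>))"

definition risk :: "nat \<Rightarrow> real \<Rightarrow> ((nat \<Rightarrow> real) \<Rightarrow> (nat \<Rightarrow> real)) \<Rightarrow> (nat \<Rightarrow> real) \<Rightarrow> ennreal" where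
  "risk n \<sigma> fh f = ennreal (1 / real n) *
     (\<integral>\<^sup>+ e. ennreal (sqnorm n (\<lambda>i. fh (restrict (\<lambda>k. f k + e k) {..<n}) i - f i)) \<partial>gauss_noise n \<sigma>)"

definition subset_est :: "nat \<Rightarrow> (nat \<Rightarrow> nat \<Rightarrow> real) \<Rightarrow> nat set \<Rightarrow> (nat \<Rightarrow> real) \<Rightarrow> (nat \<Rightarrow> real)" where
  "subset_est n \<phi> I y = (\<lambda>i. \<Sum>j\<in>I. \<phi> j i * (\<Sum>k<n. \<phi> j k * y k))"

definition avg_est :: "nat \<Rightarrow> (nat \<Rightarrow> nat \<Rightarrow> real) \<Rightarrow> (nat set \<Rightarrow> real) \<Rightarrow> (nat \<Rightarrow> real) \<Rightarrow> (nat \<Rightarrow> real)" where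
  "avg_est n \<phi> w y = (\<lambda>i. \<Sum>I\<in>Pow {..<n}. w I * subset_est n \<phi> I y i)"

definition weight_simplex :: "nat \<Rightarrow> (nat set \<Rightarrow> real) set" where
  "weight_simplex n = {w. (\<forall>I\<in>Pow {..<n}. 0 \<le> w I) \<and> (\<Sum>I\<in>Pow {..<n}. w I) = 1}"

text \<open>R_n(w* | M_AS, f) = min over the simplex (the infimum is attained).\<close>
definition oracle_risk :: "nat \<Rightarrow> real \<Rightarrow> (nat \<Rightarrow> nat \<Rightarrow> real) \<Rightarrow> (nat \<Rightarrow> real) \<Rightarrow> ennreal" where
  "oracle_risk n \<sigma> \<phi> f = (INF w\<in>weight_simplex n. risk n \<sigma> (avg_est n \<phi> w) f)"

definition estimators :: "nat \<Rightarrow> ((nat \<Rightarrow> real) \<Rightarrow> (nat \<Rightarrow> real)) set" where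
  "estimators n = measurable (PiM {..<n} (\<lambda>_. borel)) (PiM {..<n} (\<lambda>_. borel))"

definition Theta :: "nat \<Rightarrow> real \<Rightarrow> (nat \<Rightarrow> real) set" where
  "Theta n \<alpha> = {\<theta>. \<exists>\<pi>. \<pi> permutes {..<n} \<and>
      \<theta> = (\<lambda>j. if j < n then real (\<pi> j + 1) powr (- \<alpha>) else 0)}"

definition f_of :: "nat \<Rightarrow> (nat \<Rightarrow> nat \<Rightarrow> real) \<Rightarrow> (nat \<Rightarrow> real) \<Rightarrow> (nat \<Rightarrow> real)" where
  "f_of n \<phi> \<theta> = (\<lambda>i. if i < n then sqrt (real n) * (\<Sum>j<n. \<theta> j * \<phi> j i) else 0)"

end

theory Submission
  imports Defs
begin

text \<open>
  Fix a large constant \<open>T\<close>. About \<open>k = (n / T) powr (1 / (2 \<alpha>))\<close> of the values have signal-to-noise ratio of order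
  \<open>T\<close>. Since \<open>k = o(n)\<close>, each of them can be hidden among \<open>L\<close> positions that otherwise carry much
  smaller values, where \<open>L\<close> depends on \<open>T\<close> only and these sets are disjoint for the different values.
  Once \<open>L\<close> is large compared with the second moment \<open>exp (2 T / \<sigma>\<^sup>2)\<close> of the likelihood ratios, no
  estimator can locate a hidden value, which costs a constant fraction of its square. Averaging over all
  permutations adds these losses up to a risk of order \<open>k powr (1 - 2 \<alpha>)\<close>, which is
  \<open>T powr (1 - 1 / (2 \<alpha>))\<close> times \<open>n powr (1 / (2 \<alpha>) - 1)\<close>, while the single subset of the \<open>n powr (1 / (2 \<alpha>))\<close>
  largest values shows that the oracle risk is \<open>O(n powr (1 / (2 \<alpha>) - 1))\<close>. Now let \<open>T\<close> tend to infinity.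
\<close>

section \<open>Shifts of Gaussian noise\<close>

abbreviation normal_measure :: "real \<Rightarrow> real measure" where
  "normal_measure \<sigma> \<equiv> density lborel (normal_density 0 \<sigma>)"

lemma prob_space_gauss_noise:
  assumes "\<sigma> > 0"
  shows "prob_space (gauss_noise n \<sigma>)"
  unfolding gauss_noise_def
  by (intro prob_space_PiM prob_space_normal_density assms)

lemma sets_gauss_noise [measurable_cong]:
  "sets (gauss_noise n \<sigma>) = sets (PiM {..<n} (\<lambda>_. borel))"
  unfolding gauss_noise_def by (intro sets_PiM_cong) auto

lemma restrict_shift_measurable [measurable]:
  "(\<lambda>e. restrict (\<lambda>k. d k + e k) {..<n}) \<in> measurable (PiM {..<n} (\<lambda>_. borel)) (PiM {..<n} (\<lambda>_. borel :: real measure))"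
  by (rule measurable_restrict) (auto intro!: borel_measurable_add measurable_component_singleton)

text \<open>Likelihood ratio of the normal law with mean \<open>d\<close> to the centred one, both
  with standard deviation \<open>\<sigma>\<close>.\<close>

definition tilt :: "real \<Rightarrow> real \<Rightarrow> real \<Rightarrow> real" where
  "tilt \<sigma> d x = exp (d * x / \<sigma>\<^sup>2 - d\<^sup>2 / (2 * \<sigma>\<^sup>2))"

lemma tilt_measurable [measurable]: "tilt \<sigma> d \<in> borel_measurable borel"
  unfolding tilt_def by measurable

lemma normal_density_tilt:
  assumes "\<sigma> > 0"
  shows "normal_density 0 \<sigma> x * tilt \<sigma> d x = normal_density 0 \<sigma> (x - d)"
proof -
  have "- (x\<^sup>2) / (2 * \<sigma>\<^sup>2) + (d * x / \<sigma>\<^sup>2 - d\<^sup>2 / (2 * \<sigma>\<^sup>2)) = - ((x - d)\<^sup>2) / (2 * \<sigma>\<^sup>2)"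
    using assms by (simp add: field_simps power2_eq_square)
  then show ?thesis
    by (simp add: normal_density_def tilt_def exp_add[symmetric])
qed

text \<open>Squaring doubles the linear term in the exponent, and completing the square gives the
  likelihood ratio for the shift \<open>2 * d\<close> times a constant. Second moments thus reduce
  to total masses, without a further Gaussian integral.\<close>

lemma tilt_square:
  "(tilt \<sigma> d x)\<^sup>2 = exp (d\<^sup>2 / \<sigma>\<^sup>2) * tilt \<sigma> (2 * d) x"
proof -
  have "(tilt \<sigma> d x)\<^sup>2 = exp (2 * (d * x / \<sigma>\<^sup>2 - d\<^sup>2 / (2 * \<sigma>\<^sup>2)))"
    unfolding tilt_def by (simp add: exp_double power2_eq_square flip: exp_add)
  also have "2 * (d * x / \<sigma>\<^sup>2 - d\<^sup>2 / (2 * \<sigma>\<^sup>2)) = d\<^sup>2 / \<sigma>\<^sup>2 + (2 * d * x / \<sigma>\<^sup>2 - (2 * d)\<^sup>2 / (2 * \<sigma>\<^sup>2))"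
    \<comment> \<open>For \<open>\<sigma> = 0\<close> all quotients are 0 by convention, so no
      assumption on \<open>\<sigma>\<close> is made.\<close>
    by (cases "\<sigma> = 0") (simp_all add: field_simps power2_eq_square)
  finally show ?thesis by (simp only: tilt_def exp_add)
qed

lemma nn_integral_normal_shift:
  assumes "\<sigma> > 0" and [measurable]: "g \<in> borel_measurable borel"
  shows "(\<integral>\<^sup>+x. g (d + x) \<partial>normal_measure \<sigma>)
       = (\<integral>\<^sup>+x. ennreal (tilt \<sigma> d x) * g x \<partial>normal_measure \<sigma>)"
proof -
  have "(\<integral>\<^sup>+x. ennreal (tilt \<sigma> d x) * g x \<partial>normal_measure \<sigma>)
      = (\<integral>\<^sup>+x. ennreal (normal_density 0 \<sigma> (x - d)) * g x \<partial>lborel)"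
    by (subst nn_integral_density)
       (auto simp: normal_density_tilt[OF assms(1), symmetric] ennreal_mult tilt_def mult.assoc intro!: nn_integral_cong)
  also have "\<dots> = (\<integral>\<^sup>+x. ennreal (normal_density 0 \<sigma> x) * g (d + x) \<partial>lborel)"
    by (subst nn_integral_real_affine[where c=1 and t=d]) auto
  also have "\<dots> = (\<integral>\<^sup>+x. g (d + x) \<partial>normal_measure \<sigma>)"
    by (subst nn_integral_density) auto
  finally show ?thesis ..
qed

text \<open>Likelihood ratio of the noise translated by \<open>d\<close> to the noise itself; it
  factorises by independence of the coordinates.\<close>

definition lik :: "nat \<Rightarrow> real \<Rightarrow> (nat \<Rightarrow> real) \<Rightarrow> (nat \<Rightarrow> real) \<Rightarrow> real" where
  "lik n \<sigma> d e = (\<Prod>k<n. tilt \<sigma> (d k) (e k))"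

lemma lik_nonneg: "0 \<le> lik n \<sigma> d e"
  unfolding lik_def tilt_def by (intro prod_nonneg) auto

lemma lik_measurable [measurable]:
  "lik n \<sigma> d \<in> borel_measurable (PiM {..<n} (\<lambda>_. borel))"
  unfolding lik_def by measurable

lemma lik_square:
  "(lik n \<sigma> d e)\<^sup>2 = exp (sqnorm n d / \<sigma>\<^sup>2) * lik n \<sigma> (\<lambda>k. 2 * d k) e"
  unfolding lik_def sqnorm_def
  by (simp add: prod_power_distrib tilt_square prod.distrib exp_sum sum_divide_distrib)

text \<open>The finite-dimensional Cameron-Martin formula. Both measures give every box the product
  of the shifted one-dimensional masses, so both are the product measure of the shifted marginals.
  The \<open>restrict\<close> keeps shifted points inside the extensional functions that form the
  space of \<open>PiM\<close>.\<close>

lemma distr_gauss_noise_shift: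
  assumes "\<sigma> > 0"
  shows "distr (gauss_noise n \<sigma>) (PiM {..<n} (\<lambda>_. borel)) (\<lambda>e. restrict (\<lambda>k. d k + e k) {..<n})
       = density (gauss_noise n \<sigma>) (\<lambda>e. ennreal (lik n \<sigma> d e))"
proof -
  define N where "N = normal_measure \<sigma>"
  define M where "M = (\<lambda>i. distr N borel (\<lambda>x. d i + x))"
  interpret N: prob_space N unfolding N_def using assms by (rule prob_space_normal_density)
  have sN [measurable_cong]: "sets N = sets borel" by (simp add: N_def)
  have ps: "prob_space (M i)" for i
    unfolding M_def by (rule N.prob_space_distr) measurable
  interpret P: product_sigma_finite "\<lambda>_::nat. N"
    by unfold_locales
  interpret Q: product_sigma_finite M
    by (intro product_sigma_finite.intro prob_space_imp_sigma_finite ps)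
  have G: "gauss_noise n \<sigma> = PiM {..<n} (\<lambda>_. N)" by (simp add: gauss_noise_def N_def)
  have sQ: "sets (PiM {..<n} M) = sets (PiM {..<n} (\<lambda>_. borel))"
    by (intro sets_PiM_cong) (auto simp: M_def)
  have M_A: "emeasure (M i) A = emeasure N ((\<lambda>x. d i + x) -` A)" if "A \<in> sets borel" for i A
    unfolding M_def using that by (subst emeasure_distr) (auto simp: N_def)
  have "distr (gauss_noise n \<sigma>) (PiM {..<n} (\<lambda>_. borel)) (\<lambda>e. restrict (\<lambda>k. d k + e k) {..<n}) = PiM {..<n} M"
  proof (rule Q.PiM_eqI)
    fix A assume "\<And>i. i \<in> {..<n} \<Longrightarrow> A i \<in> sets (M i)"
    then have A[measurable]: "\<And>i. i \<in> {..<n} \<Longrightarrow> A i \<in> sets borel" by (simp add: M_def)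
    have "emeasure (distr (gauss_noise n \<sigma>) (PiM {..<n} (\<lambda>_. borel)) (\<lambda>e. restrict (\<lambda>k. d k + e k) {..<n})) (Pi\<^sub>E {..<n} A)
        = emeasure (gauss_noise n \<sigma>) ((\<lambda>e. restrict (\<lambda>k. d k + e k) {..<n}) -` Pi\<^sub>E {..<n} A \<inter> space (gauss_noise n \<sigma>))"
      by (rule emeasure_distr) (auto intro!: sets_PiM_I_finite A)
    also have "(\<lambda>e. restrict (\<lambda>k. d k + e k) {..<n}) -` Pi\<^sub>E {..<n} A \<inter> space (gauss_noise n \<sigma>)
       = Pi\<^sub>E {..<n} (\<lambda>i. (\<lambda>x. d i + x) -` A i)"
      unfolding G space_PiM by (auto simp: PiE_iff extensional_def N_def)
    also have "emeasure (gauss_noise n \<sigma>) \<dots> = (\<Prod>i<n. emeasure N ((\<lambda>x. d i + x) -` A i))"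
    proof -
      have "(\<lambda>x. d i + x) -` A i \<in> sets N" if "i < n" for i
        using measurable_sets_borel[of "\<lambda>x. d i + x" borel "A i"] A that by (simp add: sN)
      then show ?thesis
        unfolding G by (intro P.emeasure_PiM) auto
    qed
    also have "\<dots> = (\<Prod>i<n. emeasure (M i) (A i))"
      by (intro prod.cong) (auto simp: M_A A)
    finally show "emeasure (distr (gauss_noise n \<sigma>) (PiM {..<n} (\<lambda>_. borel)) (\<lambda>e. restrict (\<lambda>k. d k + e k) {..<n})) (Pi\<^sub>E {..<n} A) = (\<Prod>i<n. emeasure (M i) (A i))" .
  qed (simp_all add: sQ)
  also have "\<dots> = density (gauss_noise n \<sigma>) (\<lambda>e. ennreal (lik n \<sigma> d e))"
  proof (rule Q.PiM_eqI[symmetric])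
    fix A assume "\<And>i. i \<in> {..<n} \<Longrightarrow> A i \<in> sets (M i)"
    then have A[measurable]: "\<And>i. i \<in> {..<n} \<Longrightarrow> A i \<in> sets borel" by (simp add: M_def)
    \<comment> \<open>On the space of the product measure the indicator of a box factorises like the
      density, so the integral over a box splits into one-dimensional integrals.\<close>
    have *: "ennreal (lik n \<sigma> d e) * indicator (Pi\<^sub>E {..<n} A) e
       = (\<Prod>i<n. ennreal (tilt \<sigma> (d i) (e i)) * indicator (A i) (e i))"
      if "e \<in> space (gauss_noise n \<sigma>)" for e
    proof -
      have "indicator (Pi\<^sub>E {..<n} A) e = (\<Prod>i<n. indicator (A i) (e i) :: ennreal)"
        using that unfolding G space_PiM
        by (auto simp: indicator_def PiE_iff split: if_splits)
      then show ?thesis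
        by (simp add: prod.distrib lik_def prod_ennreal tilt_def)
    qed
    have "emeasure (density (gauss_noise n \<sigma>) (\<lambda>e. ennreal (lik n \<sigma> d e))) (Pi\<^sub>E {..<n} A)
       = (\<integral>\<^sup>+e. (\<Prod>i<n. ennreal (tilt \<sigma> (d i) (e i)) * indicator (A i) (e i)) \<partial>gauss_noise n \<sigma>)"
      by (subst emeasure_density)
         (auto simp: * sets_gauss_noise intro!: nn_integral_cong sets_PiM_I_finite A)
    also have "\<dots> = (\<Prod>i<n. \<integral>\<^sup>+x. ennreal (tilt \<sigma> (d i) x) * indicator (A i) x \<partial>N)"
      unfolding G by (rule P.product_nn_integral_prod) auto
    also have "\<dots> = (\<Prod>i<n. emeasure (M i) (A i))"
    proof (intro prod.cong refl)
      fix i assume "i \<in> {..<n}"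
      then have [measurable]: "A i \<in> sets borel" by (rule A)
      have "(\<integral>\<^sup>+x. ennreal (tilt \<sigma> (d i) x) * indicator (A i) x \<partial>N)
         = (\<integral>\<^sup>+x. indicator (A i) (d i + x) \<partial>N)"
        unfolding N_def by (rule nn_integral_normal_shift[symmetric]) (auto simp: assms)
      also have "\<dots> = (\<integral>\<^sup>+x. indicator (A i) x \<partial>M i)"
        unfolding M_def by (subst nn_integral_distr) auto
      also have "\<dots> = emeasure (M i) (A i)"
        by (rule nn_integral_indicator) (simp add: M_def)
      finally show "(\<integral>\<^sup>+x. ennreal (tilt \<sigma> (d i) x) * indicator (A i) x \<partial>N) = emeasure (M i) (A i)" .
    qed
    finally show "emeasure (density (gauss_noise n \<sigma>) (\<lambda>e. ennreal (lik n \<sigma> d e))) (Pi\<^sub>E {..<n} A)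
       = (\<Prod>i\<in>{..<n}. emeasure (M i) (A i))" .
  qed (simp_all add: sQ sets_gauss_noise)
  finally show ?thesis .
qed

lemma nn_integral_gauss_noise_shift:
  assumes "\<sigma> > 0" and [measurable]: "g \<in> borel_measurable (PiM {..<n} (\<lambda>_. borel))"
  shows "(\<integral>\<^sup>+e. g (restrict (\<lambda>k. d k + e k) {..<n}) \<partial>gauss_noise n \<sigma>)
       = (\<integral>\<^sup>+e. ennreal (lik n \<sigma> d e) * g e \<partial>gauss_noise n \<sigma>)"
proof -
  have "(\<integral>\<^sup>+e. g (restrict (\<lambda>k. d k + e k) {..<n}) \<partial>gauss_noise n \<sigma>)
     = (\<integral>\<^sup>+e. g e \<partial>distr (gauss_noise n \<sigma>) (PiM {..<n} (\<lambda>_. borel)) (\<lambda>e. restrict (\<lambda>k. d k + e k) {..<n}))"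
    by (subst nn_integral_distr) auto
  also have "\<dots> = (\<integral>\<^sup>+e. ennreal (lik n \<sigma> d e) * g e \<partial>gauss_noise n \<sigma>)"
    unfolding distr_gauss_noise_shift[OF assms(1)] by (subst nn_integral_density) auto
  finally show ?thesis .
qed

lemma nn_integral_lik:
  assumes "\<sigma> > 0"
  shows "(\<integral>\<^sup>+e. ennreal (lik n \<sigma> d e) \<partial>gauss_noise n \<sigma>) = 1"
  using nn_integral_gauss_noise_shift[OF assms, of "\<lambda>_. 1" n d]
    prob_space.emeasure_space_1[OF prob_space_gauss_noise[OF assms]]
  by simp

lemma nn_integral_lik_square:
  assumes "\<sigma> > 0"
  shows "(\<integral>\<^sup>+e. ennreal ((lik n \<sigma> d e)\<^sup>2) \<partial>gauss_noise n \<sigma>) = ennreal (exp (sqnorm n d / \<sigma>\<^sup>2))"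
  by (simp add: lik_square ennreal_mult lik_nonneg nn_integral_cmult nn_integral_lik[OF assms])

text \<open>Changes the mean of the observation from \<open>f'\<close> to \<open>f\<close> at the
  price of a likelihood ratio. Several candidate means can then be compared under one probability
  measure.\<close>

lemma gauss_noise_shift_base:
  assumes "\<sigma> > 0" and [measurable]: "h \<in> borel_measurable (PiM {..<n} (\<lambda>_. borel))"
  shows "(\<integral>\<^sup>+e. h (restrict (\<lambda>k. f' k + e k) {..<n}) \<partial>gauss_noise n \<sigma>)
       = (\<integral>\<^sup>+e. ennreal (lik n \<sigma> (\<lambda>k. f' k - f k) e) * h (restrict (\<lambda>k. f k + e k) {..<n}) \<partial>gauss_noise n \<sigma>)"
proof -
  have "restrict (\<lambda>k. f k + restrict (\<lambda>k. (f' k - f k) + e k) {..<n} k) {..<n}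
     = restrict (\<lambda>k. f' k + e k) {..<n}" for e
    by (auto simp: restrict_def)
  then show ?thesis
    using nn_integral_gauss_noise_shift[OF assms(1), of "\<lambda>e. h (restrict (\<lambda>k. f k + e k) {..<n})" n "\<lambda>k. f' k - f k"]
    by simp
qed

section \<open>Second moments of the noise and of its linear functionals\<close>

lemma gauss_noise_second_moment:
  assumes "\<sigma> > 0" "i < n" "k < n"
  shows "integrable (gauss_noise n \<sigma>) (\<lambda>e. e i * e k)"
    and "(\<integral>e. e i * e k \<partial>gauss_noise n \<sigma>) = (if i = k then \<sigma>\<^sup>2 else 0)"
proof -
  define N where "N = normal_measure \<sigma>"
  interpret N: prob_space N unfolding N_def using assms(1) by (rule prob_space_normal_density)
  interpret P: product_sigma_finite "\<lambda>_::nat. N"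
    by unfold_locales
  have G: "gauss_noise n \<sigma> = PiM {..<n} (\<lambda>_. N)" by (simp add: gauss_noise_def N_def)
  \<comment> \<open>Writes \<open>e i * e k\<close> as a product over all coordinates: a coordinate
    contributes \<open>x * x\<close>, \<open>x\<close> or \<open>1\<close> according to how many of
    \<open>i\<close> and \<open>k\<close> it equals. This covers \<open>i = k\<close> and
    \<open>i \<noteq> k\<close> at once.\<close>
  define f :: "nat \<Rightarrow> real \<Rightarrow> real" where
    "f l x = (if l = i then x else 1) * (if l = k then x else 1)" for l x
  have prod_f: "(\<Prod>l<n. f l (e l)) = e i * e k" for e
    using assms by (simp add: f_def prod.distrib)
  have m1: "integrable N (\<lambda>x. x)" "(\<integral>x. x \<partial>N) = 0"
    unfolding N_def
    using integrable_normal_moment_nz_1[OF assms(1), of 0] integral_normal_moment_nz_1[OF assms(1), of 0]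
    by (simp_all add: integrable_density integral_density)
  have m2: "integrable N (\<lambda>x. x * x)" "(\<integral>x. x * x \<partial>N) = \<sigma>\<^sup>2"
    unfolding N_def
    using integrable_normal_moment[OF assms(1), of 0 2] integral_normal_moment_even[OF assms(1), of 0 1]
    by (simp_all add: integrable_density integral_density power2_eq_square)
  have int: "integrable N (f l)" for l
    unfolding f_def using m1 m2 by (cases "l = i"; cases "l = k") auto
  show "integrable (gauss_noise n \<sigma>) (\<lambda>e. e i * e k)"
    using P.product_integrable_prod[of "{..<n}" f] int unfolding prod_f G by simp
  have "(\<integral>e. e i * e k \<partial>gauss_noise n \<sigma>) = (\<Prod>l<n. \<integral>x. f l x \<partial>N)"
    using P.product_integral_prod[of "{..<n}" f] int unfolding prod_f G by simp
  also have "\<dots> = (if i = k then \<sigma>\<^sup>2 else 0)"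
  proof (cases "i = k")
    case True
    then have "(\<integral>x. f l x \<partial>N) = (if l = i then \<sigma>\<^sup>2 else 1)" for l
      using m2 by (auto simp: f_def N.prob_space)
    then show ?thesis using True assms by simp
  next
    case False
    then have "(\<integral>x. f i x \<partial>N) = 0" using m1 by (simp add: f_def)
    then show ?thesis using False assms by (auto intro!: prod_zero)
  qed
  finally show "(\<integral>e. e i * e k \<partial>gauss_noise n \<sigma>) = (if i = k then \<sigma>\<^sup>2 else 0)" .
qed

lemma gauss_noise_linear_second_moment:
  assumes "\<sigma> > 0"
  shows "integrable (gauss_noise n \<sigma>) (\<lambda>e. (\<Sum>k<n. a k * e k)\<^sup>2)"
    and "(\<integral>e. (\<Sum>k<n. a k * e k)\<^sup>2 \<partial>gauss_noise n \<sigma>) = \<sigma>\<^sup>2 * (\<Sum>k<n. (a k)\<^sup>2)"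
proof -
  have sq: "(\<Sum>k<n. a k * e k)\<^sup>2 = (\<Sum>i<n. \<Sum>k<n. (a i * a k) * (e i * e k))" for e :: "nat \<Rightarrow> real"
    unfolding power2_eq_square sum_product by (simp add: ac_simps)
  show "integrable (gauss_noise n \<sigma>) (\<lambda>e. (\<Sum>k<n. a k * e k)\<^sup>2)"
    unfolding sq using gauss_noise_second_moment(1)[OF assms]
    by (intro Bochner_Integration.integrable_sum integrable_mult_right) auto
  have "(\<integral>e. (\<Sum>k<n. a k * e k)\<^sup>2 \<partial>gauss_noise n \<sigma>)
     = (\<Sum>i<n. \<Sum>k<n. (a i * a k) * (if i = k then \<sigma>\<^sup>2 else 0))"
    unfolding sq using gauss_noise_second_moment[OF assms]
    by (subst Bochner_Integration.integral_sum)
       (auto intro!: sum.cong integrable_mult_right Bochner_Integration.integrable_sum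
          simp: Bochner_Integration.integral_sum)
  also have "\<dots> = \<sigma>\<^sup>2 * (\<Sum>k<n. (a k)\<^sup>2)"
    by (simp add: if_distrib[of "\<lambda>x. _ * x"] sum_distrib_left power2_eq_square ac_simps cong: if_cong)
  finally show "(\<integral>e. (\<Sum>k<n. a k * e k)\<^sup>2 \<partial>gauss_noise n \<sigma>) = \<sigma>\<^sup>2 * (\<Sum>k<n. (a k)\<^sup>2)" .
qed

section \<open>A needle hidden among many positions\<close>

text \<open>The pointwise bound \<open>l \<le> K + l\<^sup>2 / K\<close> with \<open>K = 4 * C\<close> replaces the likelihood ratio by its second
  moment; the disjointness of the events controls the first summand.\<close>
lemma needle_detection:
  fixes l :: "'b \<Rightarrow> 'a \<Rightarrow> real"
  assumes M: "prob_space M" and fin: "finite S"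
    and l [measurable]: "\<And>s. s \<in> S \<Longrightarrow> l s \<in> borel_measurable M"
    and l2: "\<And>s. s \<in> S \<Longrightarrow> (\<integral>\<^sup>+e. ennreal ((l s e)\<^sup>2) \<partial>M) \<le> ennreal C"
    and C: "C > 0" "16 * C \<le> real (card S)"
    and G [measurable]: "\<And>s. s \<in> S \<Longrightarrow> G s \<in> sets M"
    and disj: "disjoint_family_on G S"
  shows "(\<Sum>s\<in>S. \<integral>\<^sup>+e. ennreal (l s e) * indicator (G s) e \<partial>M) \<le> ennreal (real (card S) / 2)"
proof -
  interpret prob_space M by fact
  have le: "ennreal (l s e) * indicator (G s) e
      \<le> ennreal (4 * C) * indicator (G s) e + ennreal (1 / (4 * C)) * ennreal ((l s e)\<^sup>2)" for s e
  proof (cases "e \<in> G s")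
    case True
    have "l s e * (4 * C) \<le> (4 * C)\<^sup>2 + (l s e)\<^sup>2"
      using sum_squares_bound[of "l s e" "4 * C", unfolded mult.assoc[of 2]]
        zero_le_power2[of "4 * C"] zero_le_power2[of "l s e"] by linarith
    then have "l s e \<le> 4 * C + 1 / (4 * C) * (l s e)\<^sup>2"
      using C by (simp add: field_simps power2_eq_square)
    then show ?thesis
      using True C by (simp add: ennreal_mult[symmetric] ennreal_plus[symmetric] ennreal_leI del: ennreal_plus)
  qed simp
  have "(\<integral>\<^sup>+e. ennreal (l s e) * indicator (G s) e \<partial>M) \<le> ennreal (4 * C) * emeasure M (G s) + ennreal (1 / 4)"
    if s: "s \<in> S" for s
  proof -
    have [measurable]: "l s \<in> borel_measurable M" "G s \<in> sets M" using l G s by auto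
    have "(\<integral>\<^sup>+e. ennreal (l s e) * indicator (G s) e \<partial>M)
      \<le> (\<integral>\<^sup>+e. ennreal (4 * C) * indicator (G s) e + ennreal (1 / (4 * C)) * ennreal ((l s e)\<^sup>2) \<partial>M)"
      by (intro nn_integral_mono le)
    also have "\<dots> = ennreal (4 * C) * emeasure M (G s) + ennreal (1 / (4 * C)) * (\<integral>\<^sup>+e. ennreal ((l s e)\<^sup>2) \<partial>M)"
      by (subst nn_integral_add) (auto simp: nn_integral_cmult)
    also have "\<dots> \<le> ennreal (4 * C) * emeasure M (G s) + ennreal (1 / (4 * C)) * ennreal C"
      by (intro add_left_mono mult_left_mono l2 s) auto
    also have "ennreal (1 / (4 * C)) * ennreal C = ennreal (1 / 4)"
      using C by (simp add: ennreal_mult[symmetric] del: ennreal_plus)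
    finally show ?thesis .
  qed
  then have "(\<Sum>s\<in>S. \<integral>\<^sup>+e. ennreal (l s e) * indicator (G s) e \<partial>M)
     \<le> (\<Sum>s\<in>S. ennreal (4 * C) * emeasure M (G s) + ennreal (1 / 4))"
    by (rule sum_mono)
  also have "\<dots> = ennreal (4 * C) * emeasure M (\<Union>s\<in>S. G s) + ennreal (real (card S) / 4)"
    using disj fin G
    by (simp add: sum.distrib sum_distrib_left[symmetric] sum_emeasure image_subset_iff ennreal_of_nat_eq_real_of_nat
         ennreal_mult[symmetric] del: ennreal_plus)
  also have "\<dots> \<le> ennreal (4 * C) * 1 + ennreal (real (card S) / 4)"
    by (intro add_right_mono mult_left_mono emeasure_le_1) auto
  \<comment> \<open>Disjoint events have total mass at most 1, so they cost \<open>4 * C\<close> in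
    all, which is at most a quarter of \<open>card S\<close> by assumption. The second moments cost
    another quarter.\<close>
  also have "\<dots> \<le> ennreal (real (card S) / 2)"
    using C by (simp add: ennreal_plus[symmetric] ennreal_leI del: ennreal_plus)
  finally show ?thesis .
qed

text \<open>An estimator \<open>c\<close> yields a test for the place of the needle, whose value is
  \<open>a\<close>, while position \<open>t\<close> carries \<open>u t\<close> if the needle is
  elsewhere. Whenever the test errs, the squared loss is at least \<open>\<delta>\<^sup>2\<close>,
  and by \<open>needle_detection\<close> the test is right with average probability at most one
  half.\<close>

lemma needle_estimation:
  fixes l :: "'b \<Rightarrow> 'a \<Rightarrow> real"
  assumes M: "prob_space M" and fin: "finite S"
    and l [measurable]: "\<And>s. s \<in> S \<Longrightarrow> l s \<in> borel_measurable M"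
    and l1: "\<And>s. s \<in> S \<Longrightarrow> (\<integral>\<^sup>+e. ennreal (l s e) \<partial>M) = 1"
    and l2: "\<And>s. s \<in> S \<Longrightarrow> (\<integral>\<^sup>+e. ennreal ((l s e)\<^sup>2) \<partial>M) \<le> ennreal C"
    and C: "C > 0" "16 * C \<le> real (card S)"
    and c [measurable]: "\<And>s. s \<in> S \<Longrightarrow> c s \<in> borel_measurable M"
    and \<delta>: "0 \<le> \<delta>" "\<And>s. s \<in> S \<Longrightarrow> u s \<le> a - 2 * \<delta>"
  shows "ennreal (\<delta>\<^sup>2 * real (card S) / 2) \<le>
    (\<Sum>s\<in>S. \<integral>\<^sup>+e. ennreal (l s e) * ennreal ((c s e - a)\<^sup>2 + (\<Sum>t\<in>S - {s}. (c t e - u t)\<^sup>2)) \<partial>M)"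
    (is "_ \<le> ?X")
proof -
  \<comment> \<open>The test decides for \<open>s\<close> if \<open>s\<close> is the only position
    in \<open>S\<close> whose estimate reaches \<open>a - \<delta>\<close>. Uniqueness makes the
    events disjoint.\<close>
  define G where "G s = {e\<in>space M. a - \<delta> \<le> c s e \<and> (\<forall>t\<in>S - {s}. c t e < a - \<delta>)}" for s
  have G [measurable]: "G s \<in> sets M" if "s \<in> S" for s
  proof -
    have "countable (S - {s})" using fin by (simp add: countable_finite)
    then show ?thesis using that unfolding G_def by measurable
  qed
  have "disjoint_family_on G S"
    unfolding disjoint_family_on_def
  proof (intro ballI impI equals0I)
    fix s t e assume "s \<in> S" "t \<in> S" "s \<noteq> t" "e \<in> G s \<inter> G t"
    then have "c t e < a - \<delta>" "a - \<delta> \<le> c t e" by (auto simp: G_def)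
    then show False by simp
  qed
  then have Y: "(\<Sum>s\<in>S. \<integral>\<^sup>+e. ennreal (l s e) * indicator (G s) e \<partial>M) \<le> ennreal (real (card S) / 2)" (is "?Y \<le> _")
    by (intro needle_detection[OF M fin l l2 C G])
  define loss where "loss s e = (c s e - a)\<^sup>2 + (\<Sum>t\<in>S - {s}. (c t e - u t)\<^sup>2)" for s e
  have loss_nonneg: "0 \<le> loss s e" for s e
    unfolding loss_def by (intro add_nonneg_nonneg sum_nonneg) auto
  \<comment> \<open>If the test misses the true \<open>s\<close>, either the estimate at
    \<open>s\<close> is more than \<open>\<delta>\<close> below \<open>a\<close>, or another
    \<open>t\<close> has an estimate of at least \<open>a - \<delta>\<close> although its value is
    at most \<open>a - 2 * \<delta>\<close>.\<close>
  have loss: "\<delta>\<^sup>2 \<le> loss s e + \<delta>\<^sup>2 * indicator (G s) e" if s: "s \<in> S" and e: "e \<in> space M" for s e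
  proof (cases "e \<in> G s")
    case False
    with e consider "c s e < a - \<delta>" | t where "t \<in> S - {s}" "a - \<delta> \<le> c t e"
      unfolding G_def by force
    then show ?thesis
    proof cases
      case 1
      then have "\<delta>\<^sup>2 \<le> (a - c s e)\<^sup>2" using \<delta> by (intro power_mono) auto
      then show ?thesis
        using sum_nonneg[of "S - {s}" "\<lambda>t. (c t e - u t)\<^sup>2"] False
        unfolding loss_def by (simp add: power2_commute[of a])
    next
      case 2
      then have "\<delta>\<^sup>2 \<le> (c t e - u t)\<^sup>2" using \<delta>(1) \<delta>(2)[of t] by (intro power_mono) auto
      also have "\<dots> \<le> (\<Sum>t\<in>S - {s}. (c t e - u t)\<^sup>2)"
        using fin 2 by (intro member_le_sum) auto
      finally show ?thesis using False unfolding loss_def by (simp add: add_increasing)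
    qed
  qed (simp add: loss_nonneg)
  have "ennreal (\<delta>\<^sup>2) \<le> (\<integral>\<^sup>+e. ennreal (l s e) * ennreal (loss s e) \<partial>M)
      + ennreal (\<delta>\<^sup>2) * (\<integral>\<^sup>+e. ennreal (l s e) * indicator (G s) e \<partial>M)" if s: "s \<in> S" for s
  proof -
    have [measurable]: "l s \<in> borel_measurable M" "G s \<in> sets M" "c s \<in> borel_measurable M"
      using l G c s by auto
    have [measurable]: "loss s \<in> borel_measurable M"
      unfolding loss_def by (intro borel_measurable_add borel_measurable_sum) auto
    have "ennreal (\<delta>\<^sup>2) = (\<integral>\<^sup>+e. ennreal (l s e) * ennreal (\<delta>\<^sup>2) \<partial>M)"
      by (simp add: nn_integral_multc l1 s)
    also have "\<dots> \<le> (\<integral>\<^sup>+e. ennreal (l s e) * ennreal (loss s e) + ennreal (\<delta>\<^sup>2) * (ennreal (l s e) * indicator (G s) e) \<partial>M)"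
    proof (intro nn_integral_mono)
      fix e assume e: "e \<in> space M"
      have "ennreal (\<delta>\<^sup>2) \<le> ennreal (loss s e + \<delta>\<^sup>2 * indicator (G s) e)"
        by (intro ennreal_leI loss s e)
      also have "\<dots> = ennreal (loss s e) + ennreal (\<delta>\<^sup>2) * indicator (G s) e"
        by (simp add: loss_nonneg indicator_def)
      finally have "ennreal (l s e) * ennreal (\<delta>\<^sup>2) \<le> ennreal (l s e) * (ennreal (loss s e) + ennreal (\<delta>\<^sup>2) * indicator (G s) e)"
        by (intro mult_left_mono) auto
      then show "ennreal (l s e) * ennreal (\<delta>\<^sup>2) \<le> ennreal (l s e) * ennreal (loss s e) + ennreal (\<delta>\<^sup>2) * (ennreal (l s e) * indicator (G s) e)"
        by (simp add: distrib_left ac_simps)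
    qed
    also have "\<dots> = (\<integral>\<^sup>+e. ennreal (l s e) * ennreal (loss s e) \<partial>M)
      + ennreal (\<delta>\<^sup>2) * (\<integral>\<^sup>+e. ennreal (l s e) * indicator (G s) e \<partial>M)"
      by (subst nn_integral_add) (auto simp: nn_integral_cmult)
    finally show ?thesis .
  qed
  then have "(\<Sum>s\<in>S. ennreal (\<delta>\<^sup>2)) \<le> ?X + ennreal (\<delta>\<^sup>2) * ?Y"
    unfolding loss_def[symmetric] sum_distrib_left sum.distrib[symmetric] by (rule sum_mono)
  \<comment> \<open>The total is split into two halves: one matches the detection bound and is
    cancelled on both sides, which avoids subtraction in \<open>ennreal\<close>.\<close>
  also have "(\<Sum>s\<in>S. ennreal (\<delta>\<^sup>2)) = ennreal (\<delta>\<^sup>2 * real (card S) / 2) + ennreal (\<delta>\<^sup>2 * real (card S) / 2)"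
    by (simp add: ennreal_plus[symmetric] ennreal_of_nat_eq_real_of_nat ennreal_mult[symmetric] mult.commute del: ennreal_plus)
  also have "?X + ennreal (\<delta>\<^sup>2) * ?Y \<le> ?X + ennreal (\<delta>\<^sup>2) * ennreal (real (card S) / 2)"
    by (intro add_left_mono mult_left_mono Y) auto
  also have "\<dots> = ennreal (\<delta>\<^sup>2 * real (card S) / 2) + ?X"
    by (simp add: ennreal_mult[symmetric] add.commute)
  finally show ?thesis
    by (simp add: ennreal_add_left_cancel_le)
qed

section \<open>Orthonormal systems and the oracle risk\<close>

definition orthonormal :: "nat \<Rightarrow> (nat \<Rightarrow> nat \<Rightarrow> real) \<Rightarrow> bool" where
  "orthonormal n \<phi> \<longleftrightarrow> (\<forall>j<n. \<forall>k<n. (\<Sum>i<n. \<phi> j i * \<phi> k i) = (if j = k then 1 else 0))"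

lemma orthonormal_coeff:
  assumes "orthonormal n \<phi>" "j < n"
  shows "(\<Sum>i<n. \<phi> j i * (\<Sum>k<n. b k * \<phi> k i)) = b j"
proof -
  have "(\<Sum>i<n. \<phi> j i * (\<Sum>k<n. b k * \<phi> k i)) = (\<Sum>i<n. \<Sum>k<n. b k * (\<phi> j i * \<phi> k i))"
    by (simp add: sum_distrib_left ac_simps)
  also have "\<dots> = (\<Sum>k<n. b k * (\<Sum>i<n. \<phi> j i * \<phi> k i))"
    by (subst sum.swap) (simp add: sum_distrib_left)
  also have "\<dots> = (\<Sum>k<n. b k * (if j = k then 1 else 0))"
    using assms by (intro sum.cong) (auto simp: orthonormal_def)
  also have "\<dots> = b j" using assms by (simp add: if_distrib[of "\<lambda>x. _ * x"] cong: if_cong)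
  finally show ?thesis .
qed

lemma sqnorm_orthonormal:
  assumes "orthonormal n \<phi>"
  shows "sqnorm n (\<lambda>i. \<Sum>j<n. b j * \<phi> j i) = (\<Sum>j<n. (b j)\<^sup>2)"
proof -
  have "sqnorm n (\<lambda>i. \<Sum>j<n. b j * \<phi> j i)
     = (\<Sum>i<n. \<Sum>j<n. b j * (\<phi> j i * (\<Sum>k<n. b k * \<phi> k i)))"
    unfolding sqnorm_def power2_eq_square by (simp add: sum_distrib_right sum_distrib_left ac_simps)
  also have "\<dots> = (\<Sum>j<n. b j * (\<Sum>i<n. \<phi> j i * (\<Sum>k<n. b k * \<phi> k i)))"
    by (subst sum.swap) (simp add: sum_distrib_left)
  also have "\<dots> = (\<Sum>j<n. (b j)\<^sup>2)"
    using orthonormal_coeff[OF assms] by (simp add: power2_eq_square)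
  finally show ?thesis .
qed

text \<open>The residual of \<open>v\<close> after subtracting its expansion in the system has
  nonnegative squared norm.\<close>

lemma orthonormal_Bessel:
  assumes "orthonormal n \<phi>"
  shows "(\<Sum>j<n. (\<Sum>i<n. \<phi> j i * v i)\<^sup>2) \<le> sqnorm n v"
proof -
  define b where "b j = (\<Sum>i<n. \<phi> j i * v i)" for j
  have "0 \<le> (\<Sum>i<n. (v i - (\<Sum>j<n. b j * \<phi> j i))\<^sup>2)" by (intro sum_nonneg) auto
  also have "\<dots> = sqnorm n v - 2 * (\<Sum>i<n. v i * (\<Sum>j<n. b j * \<phi> j i)) + sqnorm n (\<lambda>i. \<Sum>j<n. b j * \<phi> j i)"
    unfolding sqnorm_def power2_diff by (simp add: sum.distrib sum_subtractf sum_distrib_left mult.assoc)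
  also have "(\<Sum>i<n. v i * (\<Sum>j<n. b j * \<phi> j i)) = (\<Sum>j<n. b j * (\<Sum>i<n. \<phi> j i * v i))"
    unfolding sum_distrib_left by (subst sum.swap) (simp add: ac_simps)
  finally show ?thesis
    unfolding sqnorm_orthonormal[OF assms] by (simp add: b_def power2_eq_square)
qed

lemma f_of_coeff:
  assumes "orthonormal n \<phi>" "j < n"
  shows "(\<Sum>i<n. \<phi> j i * f_of n \<phi> \<theta> i) = sqrt (real n) * \<theta> j"
proof -
  have "(\<Sum>i<n. \<phi> j i * f_of n \<phi> \<theta> i) = sqrt (real n) * (\<Sum>i<n. \<phi> j i * (\<Sum>k<n. \<theta> k * \<phi> k i))"
    unfolding sum_distrib_left[of "sqrt _"] by (intro sum.cong) (auto simp: f_of_def)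
  then show ?thesis using orthonormal_coeff[OF assms] by simp
qed

lemma sqnorm_f_of_diff:
  assumes "orthonormal n \<phi>"
  shows "sqnorm n (\<lambda>i. f_of n \<phi> \<theta>' i - f_of n \<phi> \<theta> i) = real n * (\<Sum>j<n. (\<theta>' j - \<theta> j)\<^sup>2)"
proof -
  have "sqnorm n (\<lambda>i. f_of n \<phi> \<theta>' i - f_of n \<phi> \<theta> i)
     = sqnorm n (\<lambda>i. \<Sum>j<n. (sqrt (real n) * (\<theta>' j - \<theta> j)) * \<phi> j i)"
    unfolding sqnorm_def
    by (intro sum.cong arg_cong[of _ _ "\<lambda>x. x\<^sup>2"])
       (auto simp: f_of_def sum_distrib_left algebra_simps sum_subtractf)
  then show ?thesis
    unfolding sqnorm_orthonormal[OF assms] by (simp add: power_mult_distrib sum_distrib_left)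
qed

text \<open>Passes from estimating \<open>f\<close> to estimating the coefficients
  \<open>\<theta>\<close>, where permutations act simply. The factor \<open>real n\<close> later
  cancels the normalisation in \<open>risk\<close>.\<close>

lemma sqnorm_ge_coeff:
  assumes "orthonormal n \<phi>"
  shows "real n * (\<Sum>j<n. ((\<Sum>i<n. \<phi> j i * y i) / sqrt (real n) - \<theta> j)\<^sup>2) \<le> sqnorm n (\<lambda>i. y i - f_of n \<phi> \<theta> i)"
proof (cases "n = 0")
  case False
  have "real n * ((\<Sum>i<n. \<phi> j i * y i) / sqrt (real n) - \<theta> j)\<^sup>2
      = (\<Sum>i<n. \<phi> j i * (y i - f_of n \<phi> \<theta> i))\<^sup>2" if "j < n" for j
  proof -
    have "(\<Sum>i<n. \<phi> j i * (y i - f_of n \<phi> \<theta> i)) = sqrt (real n) * ((\<Sum>i<n. \<phi> j i * y i) / sqrt (real n) - \<theta> j)"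
      using False f_of_coeff[OF assms that] by (simp add: right_diff_distrib sum_subtractf)
    then show ?thesis by (simp add: power_mult_distrib)
  qed
  then show ?thesis
    using orthonormal_Bessel[OF assms, of "\<lambda>i. y i - f_of n \<phi> \<theta> i"] by (simp add: sum_distrib_left)
qed (simp add: sqnorm_def)

text \<open>The oracle does at least as well as the vertex of the simplex that puts all weight on
  \<open>I\<close>. For this projection each kept coefficient costs its noise variance and each
  dropped one its square.\<close>

lemma oracle_risk_le:
  assumes "\<sigma> > 0" "orthonormal n \<phi>" "n > 0" "I \<subseteq> {..<n}"
  shows "oracle_risk n \<sigma> \<phi> (f_of n \<phi> \<theta>)
     \<le> ennreal (\<sigma>\<^sup>2 * real (card I) / real n + (\<Sum>j\<in>{..<n} - I. (\<theta> j)\<^sup>2))"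
proof -
  interpret prob_space "gauss_noise n \<sigma>" using assms(1) by (rule prob_space_gauss_noise)
  define w :: "nat set \<Rightarrow> real" where "w J = (if J = I then 1 else 0)" for J
  have w: "w \<in> weight_simplex n"
    using assms(4) by (auto simp: weight_simplex_def w_def)
  have avg: "avg_est n \<phi> w y = subset_est n \<phi> I y" for y
    using assms(4) by (auto simp: avg_est_def w_def if_distrib[of "\<lambda>x. x * _"] fun_eq_iff cong: if_cong)
  let ?f = "f_of n \<phi> \<theta>"
  let ?z = "\<lambda>e j. \<Sum>k<n. \<phi> j k * e k"
  have sq: "sqnorm n (\<lambda>i. subset_est n \<phi> I (restrict (\<lambda>k. ?f k + e k) {..<n}) i - ?f i)
     = (\<Sum>j\<in>I. (?z e j)\<^sup>2) + real n * (\<Sum>j\<in>{..<n} - I. (\<theta> j)\<^sup>2)" for e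
  proof -
    \<comment> \<open>Coefficients of the estimation error: pure noise inside \<open>I\<close>, the
      negative signal outside.\<close>
    define b where "b j = (if j \<in> I then ?z e j else - sqrt (real n) * \<theta> j)" for j
    have "subset_est n \<phi> I (restrict (\<lambda>k. ?f k + e k) {..<n}) i - ?f i = (\<Sum>j<n. b j * \<phi> j i)" if "i < n" for i
    proof -
      have "subset_est n \<phi> I (restrict (\<lambda>k. ?f k + e k) {..<n}) i
         = (\<Sum>j\<in>I. \<phi> j i * (sqrt (real n) * \<theta> j + ?z e j))"
        unfolding subset_est_def using assms(4)
        by (intro sum.cong refl) (auto simp: distrib_left sum.distrib f_of_coeff[OF assms(2)] subset_iff)
      also have "\<dots> = (\<Sum>j<n. if j \<in> I then \<phi> j i * (sqrt (real n) * \<theta> j + ?z e j) else 0)"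
        using assms(4) by (simp add: sum.If_cases Int_absorb1)
      also have "\<dots> - ?f i = (\<Sum>j<n. b j * \<phi> j i)"
        using that unfolding f_of_def
        by (auto simp: sum_distrib_left sum_subtractf[symmetric] b_def algebra_simps intro!: sum.cong)
      finally show ?thesis .
    qed
    then have "sqnorm n (\<lambda>i. subset_est n \<phi> I (restrict (\<lambda>k. ?f k + e k) {..<n}) i - ?f i)
       = sqnorm n (\<lambda>i. \<Sum>j<n. b j * \<phi> j i)"
      unfolding sqnorm_def by (intro sum.cong) auto
    also have "\<dots> = (\<Sum>j<n. (b j)\<^sup>2)" by (rule sqnorm_orthonormal[OF assms(2)])
    also have "\<dots> = (\<Sum>j\<in>I. (b j)\<^sup>2) + (\<Sum>j\<in>{..<n} - I. (b j)\<^sup>2)"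
      using assms(4) by (subst sum.subset_diff[of I]) auto
    finally show ?thesis by (simp add: b_def power_mult_distrib sum_distrib_left)
  qed
  have "oracle_risk n \<sigma> \<phi> ?f \<le> risk n \<sigma> (avg_est n \<phi> w) ?f"
    unfolding oracle_risk_def by (rule INF_lower[OF w])
  also have "\<dots> = ennreal (1 / real n) *
      (\<integral>\<^sup>+e. ennreal ((\<Sum>j\<in>I. (?z e j)\<^sup>2) + real n * (\<Sum>j\<in>{..<n} - I. (\<theta> j)\<^sup>2)) \<partial>gauss_noise n \<sigma>)"
    by (simp add: risk_def avg sq)
  also have "(\<integral>\<^sup>+e. ennreal ((\<Sum>j\<in>I. (?z e j)\<^sup>2) + real n * (\<Sum>j\<in>{..<n} - I. (\<theta> j)\<^sup>2)) \<partial>gauss_noise n \<sigma>)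
      = ennreal (\<integral>e. (\<Sum>j\<in>I. (?z e j)\<^sup>2) + real n * (\<Sum>j\<in>{..<n} - I. (\<theta> j)\<^sup>2) \<partial>gauss_noise n \<sigma>)"
    using gauss_noise_linear_second_moment(1)[OF assms(1)]
    by (intro nn_integral_eq_integral Bochner_Integration.integrable_add Bochner_Integration.integrable_sum)
       (auto intro!: add_nonneg_nonneg mult_nonneg_nonneg sum_nonneg)
  also have "(\<integral>e. (\<Sum>j\<in>I. (?z e j)\<^sup>2) + real n * (\<Sum>j\<in>{..<n} - I. (\<theta> j)\<^sup>2) \<partial>gauss_noise n \<sigma>)
      = (\<Sum>j\<in>I. \<sigma>\<^sup>2 * (\<Sum>k<n. (\<phi> j k)\<^sup>2)) + real n * (\<Sum>j\<in>{..<n} - I. (\<theta> j)\<^sup>2)"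
    using gauss_noise_linear_second_moment[OF assms(1)]
    by (subst Bochner_Integration.integral_add) (auto simp: Bochner_Integration.integral_sum prob_space)
  also have "(\<Sum>j\<in>I. \<sigma>\<^sup>2 * (\<Sum>k<n. (\<phi> j k)\<^sup>2)) = \<sigma>\<^sup>2 * real (card I)"
    using assms(2,4) by (auto simp: orthonormal_def power2_eq_square subset_iff)
  also have "ennreal (1 / real n) * ennreal (\<sigma>\<^sup>2 * real (card I) + real n * (\<Sum>j\<in>{..<n} - I. (\<theta> j)\<^sup>2))
     = ennreal (\<sigma>\<^sup>2 * real (card I) / real n + (\<Sum>j\<in>{..<n} - I. (\<theta> j)\<^sup>2))"
    using assms(3) by (subst ennreal_mult[symmetric])
       (auto simp: add_divide_distrib sum_nonneg intro!: add_nonneg_nonneg mult_nonneg_nonneg)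
  finally show ?thesis .
qed

section \<open>Averaging over permutations\<close>

text \<open>The permutation maps positions to indices of values. Composing a transposition on the
  left therefore exchanges two values, wherever they sit, and \<open>inv \<pi> t\<close> is the
  position of value \<open>t\<close>. The zeros beyond \<open>n\<close> match
  \<open>Theta\<close>.\<close>

definition perm_vec :: "nat \<Rightarrow> (nat \<Rightarrow> real) \<Rightarrow> (nat \<Rightarrow> nat) \<Rightarrow> nat \<Rightarrow> real" where
  "perm_vec n v \<pi> = (\<lambda>j. if j < n then v (\<pi> j) else 0)"

definition coeff_est :: "nat \<Rightarrow> (nat \<Rightarrow> nat \<Rightarrow> real) \<Rightarrow> ((nat \<Rightarrow> real) \<Rightarrow> nat \<Rightarrow> real) \<Rightarrow> nat \<Rightarrow> (nat \<Rightarrow> real) \<Rightarrow> real" where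
  "coeff_est n \<phi> fh j y = (\<Sum>i<n. \<phi> j i * fh y i) / sqrt (real n)"

text \<open>The part of the risk, on the scale of \<open>\<theta>\<close>, that arises at the
  positions whose values have indices in \<open>B\<close>. The positions vary with the permutation,
  but the block of values is fixed.\<close>

definition block_risk where
  "block_risk n \<sigma> \<phi> v fh B \<pi> =
    (\<integral>\<^sup>+e. ennreal (\<Sum>j | j < n \<and> \<pi> j \<in> B.
        (coeff_est n \<phi> fh j (restrict (\<lambda>k. f_of n \<phi> (perm_vec n v \<pi>) k + e k) {..<n}) - v (\<pi> j))\<^sup>2)
      \<partial>gauss_noise n \<sigma>)"

lemma estimators_component_measurable:
  assumes "fh \<in> estimators n" "i < n"
  shows "(\<lambda>y. fh y i) \<in> borel_measurable (PiM {..<n} (\<lambda>_. borel))"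
  using measurable_compose[OF assms(1)[unfolded estimators_def] measurable_component_singleton[of i]]
    assms(2) by simp

lemma coeff_est_measurable:
  assumes "fh \<in> estimators n"
  shows "coeff_est n \<phi> fh j \<in> borel_measurable (PiM {..<n} (\<lambda>_. borel))"
proof -
  have "(\<lambda>y. fh y i) \<in> borel_measurable (PiM {..<n} (\<lambda>_. borel))" if "i < n" for i
    using assms that by (rule estimators_component_measurable)
  then show ?thesis
    unfolding coeff_est_def
    by (intro borel_measurable_divide borel_measurable_sum borel_measurable_times) auto
qed

text \<open>Disjoint blocks of values sit at disjoint sets of positions, so their losses add up to
  at most the full coefficient loss, which Bessel's inequality bounds by the loss for
  \<open>f\<close>.\<close>

lemma sum_block_risk_le_risk:
  assumes "orthonormal n \<phi>" "n > 0" "fh \<in> estimators n" "finite A" "disjoint_family_on B A"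
  shows "(\<Sum>m\<in>A. block_risk n \<sigma> \<phi> v fh (B m) \<pi>) \<le> risk n \<sigma> fh (f_of n \<phi> (perm_vec n v \<pi>))"
proof -
  note [measurable] = coeff_est_measurable[OF assms(3)]
  let ?f = "f_of n \<phi> (perm_vec n v \<pi>)"
  define y where "y e = restrict (\<lambda>k. ?f k + e k) {..<n}" for e
  have [measurable]: "y \<in> measurable (gauss_noise n \<sigma>) (PiM {..<n} (\<lambda>_. borel))"
    unfolding y_def by measurable
  let ?t = "\<lambda>e j. (coeff_est n \<phi> fh j (y e) - v (\<pi> j))\<^sup>2"
  have "(\<Sum>m\<in>A. block_risk n \<sigma> \<phi> v fh (B m) \<pi>)
     = (\<integral>\<^sup>+e. (\<Sum>m\<in>A. ennreal (\<Sum>j | j < n \<and> \<pi> j \<in> B m. ?t e j)) \<partial>gauss_noise n \<sigma>)"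
    unfolding block_risk_def y_def[symmetric] by (subst nn_integral_sum) auto
  also have "\<dots> \<le> (\<integral>\<^sup>+e. ennreal (1 / real n) * ennreal (sqnorm n (\<lambda>i. fh (y e) i - ?f i)) \<partial>gauss_noise n \<sigma>)"
  proof (intro nn_integral_mono)
    fix e
    have "(\<Sum>m\<in>A. \<Sum>j | j < n \<and> \<pi> j \<in> B m. ?t e j) = sum (?t e) (\<Union>m\<in>A. {j. j < n \<and> \<pi> j \<in> B m})"
      using assms(4,5) by (intro sum.UNION_disjoint[symmetric]) (auto simp: disjoint_family_on_def)
    also have "\<dots> \<le> (\<Sum>j<n. ?t e j)"
      by (intro sum_mono2) auto
    also have "\<dots> = 1 / real n * (real n * (\<Sum>j<n. ((\<Sum>i<n. \<phi> j i * fh (y e) i) / sqrt (real n) - perm_vec n v \<pi> j)\<^sup>2))"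
      using assms(2) by (simp add: coeff_est_def perm_vec_def)
    also have "\<dots> \<le> 1 / real n * sqnorm n (\<lambda>i. fh (y e) i - ?f i)"
      by (intro mult_left_mono sqnorm_ge_coeff[OF assms(1)]) auto
    finally show "(\<Sum>m\<in>A. ennreal (\<Sum>j | j < n \<and> \<pi> j \<in> B m. ?t e j))
       \<le> ennreal (1 / real n) * ennreal (sqnorm n (\<lambda>i. fh (y e) i - ?f i))"
      by (subst sum_ennreal) (auto simp: sum_nonneg ennreal_mult''[symmetric] sqnorm_def intro!: ennreal_leI)
  qed
  also have "\<dots> = risk n \<sigma> fh ?f"
  proof -
    have "(\<lambda>e. fh (y e) i) \<in> borel_measurable (gauss_noise n \<sigma>)" if "i < n" for i
      by (rule measurable_compose[OF _ estimators_component_measurable[OF assms(3) that]]) measurable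
    then have "(\<lambda>e. ennreal (sqnorm n (\<lambda>i. fh (y e) i - ?f i))) \<in> borel_measurable (gauss_noise n \<sigma>)"
      unfolding sqnorm_def by - (rule measurable_compose[OF _ measurable_ennreal], auto intro!: borel_measurable_sum)
    then show ?thesis unfolding risk_def y_def[symmetric] by (rule nn_integral_cmult)
  qed
  finally show ?thesis .
qed

text \<open>Only the positions of the values \<open>m\<close> and \<open>s\<close> change, each by
  \<open>v m - v s\<close> up to sign; \<open>real n\<close> comes from the factor
  \<open>sqrt (real n)\<close> in \<open>f_of\<close>.\<close>

lemma sqnorm_transpose:
  assumes "orthonormal n \<phi>" "\<pi> permutes {..<n}" "m < n" "s < n" "m \<noteq> s"
  shows "sqnorm n (\<lambda>i. f_of n \<phi> (perm_vec n v (Transposition.transpose m s \<circ> \<pi>)) i - f_of n \<phi> (perm_vec n v \<pi>) i)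
    = 2 * real n * (v m - v s)\<^sup>2"
proof -
  have "(\<Sum>j<n. (perm_vec n v (Transposition.transpose m s \<circ> \<pi>) j - perm_vec n v \<pi> j)\<^sup>2)
     = (\<Sum>j<n. (v (Transposition.transpose m s (\<pi> j)) - v (\<pi> j))\<^sup>2)"
    by (simp add: perm_vec_def)
  also have "\<dots> = (\<Sum>t<n. (v (Transposition.transpose m s t) - v t)\<^sup>2)"
    by (rule sum.reindex_bij_betw[OF permutes_imp_bij[OF assms(2)]])
  also have "\<dots> = (\<Sum>t\<in>{m, s}. (v (Transposition.transpose m s t) - v t)\<^sup>2)"
    using assms by (intro sum.mono_neutral_right) (auto simp: Transposition.transpose_def)
  also have "\<dots> = 2 * (v m - v s)\<^sup>2"
    using assms by (simp add: Transposition.transpose_def power2_commute)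
  finally show ?thesis by (simp add: sqnorm_f_of_diff[OF assms(1)])
qed

text \<open>The needle problem with reference arrangement \<open>\<pi>\<close>: hypothesis
  \<open>s\<close> exchanges the large value \<open>m\<close> with the value \<open>s\<close>, so
  the needle moves to the position that held \<open>s\<close>. The squared distance of the means is
  at most \<open>2 * real n * (v m)\<^sup>2\<close>, which gives the bound on the second moment of
  the likelihood ratios.\<close>

lemma sum_block_risk_transpose_ge:
  assumes "\<sigma> > 0" "orthonormal n \<phi>" "fh \<in> estimators n" "\<pi> permutes {..<n}"
    and S: "m < n" "S \<subseteq> {..<n}" "m \<notin> S"
    and \<delta>: "0 \<le> \<delta>" "\<And>s. s \<in> S \<Longrightarrow> 0 \<le> v s" "\<And>s. s \<in> S \<Longrightarrow> v s \<le> v m - 2 * \<delta>"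
    and card: "16 * exp (2 * real n * (v m)\<^sup>2 / \<sigma>\<^sup>2) \<le> real (card S)"
  shows "ennreal (\<delta>\<^sup>2 * real (card S) / 2)
    \<le> (\<Sum>s\<in>S. block_risk n \<sigma> \<phi> v fh (insert m S) (Transposition.transpose m s \<circ> \<pi>))"
proof -
  note [measurable] = coeff_est_measurable[OF assms(3)]
  have finS: "finite S" using S(2) finite_subset by blast
  define f where "f = f_of n \<phi> (perm_vec n v \<pi>)"
  define f' where "f' s = f_of n \<phi> (perm_vec n v (Transposition.transpose m s \<circ> \<pi>))" for s
  define y where "y = (\<lambda>e. restrict (\<lambda>k. f k + e k) {..<n})"
  have [measurable]: "y \<in> measurable (gauss_noise n \<sigma>) (PiM {..<n} (\<lambda>_. borel))"
    unfolding y_def by measurable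
  define c where "c t = coeff_est n \<phi> fh (inv \<pi> t)" for t
  have [measurable]: "c t \<in> borel_measurable (PiM {..<n} (\<lambda>_. borel))" for t
    unfolding c_def by measurable
  define l where "l s = lik n \<sigma> (\<lambda>k. f' s k - f k)" for s
  have "ennreal (\<delta>\<^sup>2 * real (card S) / 2) \<le>
    (\<Sum>s\<in>S. \<integral>\<^sup>+e. ennreal (l s e) *
       ennreal ((c s (y e) - v m)\<^sup>2 + (\<Sum>t\<in>S - {s}. (c t (y e) - v t)\<^sup>2)) \<partial>gauss_noise n \<sigma>)"
  proof (rule needle_estimation[where C = "exp (2 * real n * (v m)\<^sup>2 / \<sigma>\<^sup>2)" and c = "\<lambda>t e. c t (y e)"])
    show "prob_space (gauss_noise n \<sigma>)" by (rule prob_space_gauss_noise[OF assms(1)])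
    show "l s \<in> borel_measurable (gauss_noise n \<sigma>)" for s unfolding l_def by measurable
    show "(\<integral>\<^sup>+e. ennreal (l s e) \<partial>gauss_noise n \<sigma>) = 1" for s
      unfolding l_def by (rule nn_integral_lik[OF assms(1)])
    fix s assume s: "s \<in> S"
    then have "sqnorm n (\<lambda>i. f' s i - f i) = 2 * real n * (v m - v s)\<^sup>2"
      unfolding f'_def f_def using S by (intro sqnorm_transpose assms) auto
    also have "\<dots> \<le> 2 * real n * (v m)\<^sup>2"
      using \<delta>(1) \<delta>(2)[OF s] \<delta>(3)[OF s] by (intro mult_left_mono power_mono) auto
    finally show "(\<integral>\<^sup>+e. ennreal ((l s e)\<^sup>2) \<partial>gauss_noise n \<sigma>) \<le> ennreal (exp (2 * real n * (v m)\<^sup>2 / \<sigma>\<^sup>2))"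
      unfolding l_def nn_integral_lik_square[OF assms(1)] by (intro ennreal_leI) (simp add: divide_right_mono)
  qed (use finS \<delta> card in auto)
  also have "\<dots> \<le> (\<Sum>s\<in>S. block_risk n \<sigma> \<phi> v fh (insert m S) (Transposition.transpose m s \<circ> \<pi>))"
  proof (intro sum_mono)
    fix s assume s: "s \<in> S"
    let ?\<tau> = "Transposition.transpose m s"
    define h where "h y = ennreal (\<Sum>t\<in>S. (c t y - v (?\<tau> t))\<^sup>2)" for y
    have [measurable]: "h \<in> borel_measurable (PiM {..<n} (\<lambda>_. borel))" unfolding h_def by measurable
    have "?\<tau> t = t" if "t \<in> S - {s}" for t
      using S(3) that by (metis DiffE insertI1 transpose_apply_other)
    then have "(c s y - v m)\<^sup>2 + (\<Sum>t\<in>S - {s}. (c t y - v t)\<^sup>2) = (\<Sum>t\<in>S. (c t y - v (?\<tau> t))\<^sup>2)" for y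
      by (subst sum.remove[OF finS s]) simp
    then have "(\<integral>\<^sup>+e. ennreal (l s e) * ennreal ((c s (y e) - v m)\<^sup>2 + (\<Sum>t\<in>S - {s}. (c t (y e) - v t)\<^sup>2)) \<partial>gauss_noise n \<sigma>)
       = (\<integral>\<^sup>+e. ennreal (lik n \<sigma> (\<lambda>k. f' s k - f k) e) * h (restrict (\<lambda>k. f k + e k) {..<n}) \<partial>gauss_noise n \<sigma>)"
      by (simp add: l_def y_def h_def)
    also have "\<dots> = (\<integral>\<^sup>+e. h (restrict (\<lambda>k. f' s k + e k) {..<n}) \<partial>gauss_noise n \<sigma>)"
      by (rule gauss_noise_shift_base[symmetric]) (auto simp: assms)
    also have "\<dots> \<le> block_risk n \<sigma> \<phi> v fh (insert m S) (?\<tau> \<circ> \<pi>)"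
      unfolding block_risk_def f'_def[symmetric]
    proof (intro nn_integral_mono)
      fix e
      let ?y = "restrict (\<lambda>k. f' s k + e k) {..<n}"
      let ?t = "\<lambda>j. (coeff_est n \<phi> fh j ?y - v ((?\<tau> \<circ> \<pi>) j))\<^sup>2"
      have inv: "\<pi> (inv \<pi> t) = t" for t by (rule permutes_inverses[OF assms(4)])
      have "inj_on (inv \<pi>) S"
        using permutes_inj[OF permutes_inv[OF assms(4)]] by (rule inj_on_subset) simp
      then have "(\<Sum>t\<in>S. (c t ?y - v (?\<tau> t))\<^sup>2) = sum ?t (inv \<pi> ` S)"
        by (subst sum.reindex) (auto simp: c_def inv)
      \<comment> \<open>The block must contain \<open>m\<close>, since the needle now sits at
        position \<open>inv \<pi> s\<close>. The right side also counts position
        \<open>inv \<pi> m\<close>, which received the value \<open>s\<close>; this only adds a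
        square.\<close>
      also have "\<dots> \<le> sum ?t {j. j < n \<and> (?\<tau> \<circ> \<pi>) j \<in> insert m S}"
      proof (intro sum_mono2)
        have "inv \<pi> t < n" if "t \<in> S" for t
          using permutes_in_image[OF permutes_inv[OF assms(4)], of t] S(2) that by auto
        then show "inv \<pi> ` S \<subseteq> {j. j < n \<and> (?\<tau> \<circ> \<pi>) j \<in> insert m S}"
          using S(3) by (auto simp: inv Transposition.transpose_def)
      qed auto
      finally show "h ?y \<le> ennreal (sum ?t {j. j < n \<and> (?\<tau> \<circ> \<pi>) j \<in> insert m S})"
        unfolding h_def by (rule ennreal_leI)
    qed
    finally show "(\<integral>\<^sup>+e. ennreal (l s e) * ennreal ((c s (y e) - v m)\<^sup>2 + (\<Sum>t\<in>S - {s}. (c t (y e) - v t)\<^sup>2)) \<partial>gauss_noise n \<sigma>)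
       \<le> block_risk n \<sigma> \<phi> v fh (insert m S) (?\<tau> \<circ> \<pi>)" .
  qed
  finally show ?thesis .
qed

text \<open>The supremum dominates the average over all permutations, which is invariant under composition
  with \<open>\<tau> m s\<close>; so each \<open>F m\<close> may also be averaged over \<open>s\<close>.\<close>
lemma SUP_permutations_ge:
  fixes F :: "'b \<Rightarrow> ('a \<Rightarrow> 'a) \<Rightarrow> ennreal" and r :: "('a \<Rightarrow> 'a) \<Rightarrow> ennreal"
  assumes fin: "finite X" "finite A"
    and S: "\<And>m. m \<in> A \<Longrightarrow> finite (S m) \<and> S m \<noteq> {}"
    and \<tau>: "\<And>m s. m \<in> A \<Longrightarrow> s \<in> S m \<Longrightarrow> \<tau> m s permutes X"
    and F: "\<And>m \<pi>. m \<in> A \<Longrightarrow> \<pi> permutes X \<Longrightarrow>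
        ennreal (b * real (card (S m))) \<le> (\<Sum>s\<in>S m. F m (\<tau> m s \<circ> \<pi>))"
    and r: "\<And>\<pi>. \<pi> permutes X \<Longrightarrow> (\<Sum>m\<in>A. F m \<pi>) \<le> r \<pi>"
    and b: "0 \<le> b"
  shows "ennreal (real (card A) * b) \<le> (SUP \<pi>\<in>{\<pi>. \<pi> permutes X}. r \<pi>)"
proof -
  define P where "P = {\<pi>. \<pi> permutes X}"
  have finP: "finite P" unfolding P_def using fin(1) by (rule finite_permutations)
  have cardP: "card P > 0"
    using finP permutes_id[of X] unfolding P_def card_gt_0_iff by blast
  \<comment> \<open>Averages are kept as multiples by a cardinality, so that only cancellation of a
    positive natural number is required.\<close>
  have cancel: "x \<le> y" if "of_nat k * x \<le> of_nat k * y" "k > 0" for x y :: ennreal and k :: nat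
    using that by (subst (asm) ennreal_mult_le_mult_iff) auto
  have m: "of_nat (card P) * ennreal b \<le> (\<Sum>\<pi>\<in>P. F m \<pi>)" if m: "m \<in> A" for m
  proof (rule cancel[of "card (S m)"])
    show "card (S m) > 0" using S[OF m] by (simp add: card_gt_0_iff)
    have "of_nat (card (S m)) * (of_nat (card P) * ennreal b) = (\<Sum>\<pi>\<in>P. ennreal (b * real (card (S m))))"
      using b by (simp add: ennreal_mult' ennreal_of_nat_eq_real_of_nat ac_simps)
    also have "\<dots> \<le> (\<Sum>\<pi>\<in>P. \<Sum>s\<in>S m. F m (\<tau> m s \<circ> \<pi>))"
      by (intro sum_mono F m) (simp add: P_def)
    also have "\<dots> = (\<Sum>s\<in>S m. \<Sum>\<pi>\<in>P. F m (\<tau> m s \<circ> \<pi>))" by (rule sum.swap)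
    also have "\<dots> = (\<Sum>s\<in>S m. \<Sum>\<pi>\<in>P. F m \<pi>)"
      unfolding P_def by (intro sum.cong refl setum_permutations_compose_left[symmetric] \<tau> m)
    finally show "of_nat (card (S m)) * (of_nat (card P) * ennreal b) \<le> of_nat (card (S m)) * (\<Sum>\<pi>\<in>P. F m \<pi>)"
      by simp
  qed
  show ?thesis
  proof (rule cancel[OF _ cardP])
    have "of_nat (card P) * ennreal (real (card A) * b) = (\<Sum>m\<in>A. of_nat (card P) * ennreal b)"
      using b by (simp add: ennreal_mult ennreal_of_nat_eq_real_of_nat ac_simps)
    also have "\<dots> \<le> (\<Sum>m\<in>A. \<Sum>\<pi>\<in>P. F m \<pi>)" by (intro sum_mono m)
    also have "\<dots> = (\<Sum>\<pi>\<in>P. \<Sum>m\<in>A. F m \<pi>)" by (rule sum.swap)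
    also have "\<dots> \<le> (\<Sum>\<pi>\<in>P. SUP \<pi>\<in>P. r \<pi>)"
      using r by (intro sum_mono) (auto simp: P_def intro!: SUP_upper2)
    finally show "of_nat (card P) * ennreal (real (card A) * b) \<le> of_nat (card P) * (SUP \<pi>\<in>{\<pi>. \<pi> permutes X}. r \<pi>)"
      by (simp add: P_def)
  qed
qed

text \<open>Simultaneous needle problems, one for each \<open>m\<close> in \<open>A\<close> with its
  own set \<open>S m\<close> of small values. As the sets \<open>insert m (S m)\<close> are
  disjoint, the losses add up, each needle contributing \<open>\<delta>\<^sup>2 / 2\<close>.\<close>

lemma SUP_risk_ge:
  assumes "\<sigma> > 0" "orthonormal n \<phi>" "n > 0" "fh \<in> estimators n"
    and A: "A \<subseteq> {..<n}" "\<And>m. m \<in> A \<Longrightarrow> S m \<subseteq> {..<n} - A" "disjoint_family_on S A"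
    and \<delta>: "0 \<le> \<delta>" "\<And>i. 0 \<le> v i" "\<And>m s. m \<in> A \<Longrightarrow> s \<in> S m \<Longrightarrow> v s \<le> v m - 2 * \<delta>"
    and card: "\<And>m. m \<in> A \<Longrightarrow> 16 * exp (2 * real n * (v m)\<^sup>2 / \<sigma>\<^sup>2) \<le> real (card (S m))"
  shows "ennreal (real (card A) * (\<delta>\<^sup>2 / 2))
     \<le> (SUP \<pi>\<in>{\<pi>. \<pi> permutes {..<n}}. risk n \<sigma> fh (f_of n \<phi> (perm_vec n v \<pi>)))"
proof (rule SUP_permutations_ge)
  have finA: "finite A" using A(1) finite_subset by blast
  then show "finite A" .
  show "finite (S m) \<and> S m \<noteq> {}" if "m \<in> A" for m
  proof -
    have "0 < real (card (S m))"
      using card[OF that] by (rule less_le_trans[rotated]) simp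
    then show ?thesis by (auto simp: card_gt_0_iff)
  qed
  show "Transposition.transpose m s permutes {..<n}" if "m \<in> A" "s \<in> S m" for m s
    using that A by (intro permutes_swap_id) auto
  show "ennreal (\<delta>\<^sup>2 / 2 * real (card (S m)))
     \<le> (\<Sum>s\<in>S m. block_risk n \<sigma> \<phi> v fh (insert m (S m)) (Transposition.transpose m s \<circ> \<pi>))"
    if "m \<in> A" "\<pi> permutes {..<n}" for m \<pi>
  proof -
    have "m < n" "S m \<subseteq> {..<n}" "m \<notin> S m" using that A by blast+
    have "ennreal (\<delta>\<^sup>2 * real (card (S m)) / 2)
       \<le> (\<Sum>s\<in>S m. block_risk n \<sigma> \<phi> v fh (insert m (S m)) (Transposition.transpose m s \<circ> \<pi>))"
      by (rule sum_block_risk_transpose_ge) (use assms that \<open>m < n\<close> \<open>S m \<subseteq> {..<n}\<close> \<open>m \<notin> S m\<close> in auto)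
    then show ?thesis by (simp add: ac_simps)
  qed
  have "disjoint_family_on (\<lambda>m. insert m (S m)) A"
    using A(2,3) unfolding disjoint_family_on_def by blast
  then show "(\<Sum>m\<in>A. block_risk n \<sigma> \<phi> v fh (insert m (S m)) \<pi>)
     \<le> risk n \<sigma> fh (f_of n \<phi> (perm_vec n v \<pi>))" for \<pi>
    by (intro sum_block_risk_le_risk assms finA)
qed simp_all

section \<open>Rates for polynomially decaying coefficients\<close>

text \<open>Covers the values 0 and \<open>top\<close>, so that the oracle risk can be replaced by
  an upper bound in the denominator without first showing that it is positive.\<close>

lemma divide_left_mono_ennreal:
  fixes a b c :: ennreal
  assumes "b \<le> a"
  shows "c / a \<le> c / b"
proof -
  have "inverse a \<le> inverse b"
  proof (cases "b = 0 \<or> a = top")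
    case False
    with assms have "b \<noteq> top" by (auto simp: top_unique)
    with assms False show ?thesis
      by (cases a; cases b) (auto simp: inverse_ennreal less_le intro!: ennreal_leI le_imp_inverse_le)
  qed auto
  then show ?thesis unfolding divide_ennreal_def by (rule mult_left_mono) simp
qed

text \<open>By the mean value theorem each summand is at most the decrease of
  \<open>x powr - \<gamma> / \<gamma>\<close> over the preceding unit interval, and these decreases
  telescope.\<close>

lemma sum_powr_tail_le:
  fixes \<alpha> :: real
  assumes "\<alpha> > 1/2" "1 \<le> k" "k \<le> n"
  shows "(\<Sum>i=k..<n. real (i + 1) powr (- 2 * \<alpha>)) \<le> real k powr (1 - 2 * \<alpha>) / (2 * \<alpha> - 1)"
proof -
  define \<gamma> where "\<gamma> = 2 * \<alpha> - 1"
  have \<gamma>: "\<gamma> > 0" using assms(1) by (simp add: \<gamma>_def)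
  \<comment> \<open>The subtracted term at \<open>n\<close> strengthens the claim so that the
    induction goes through; it is dropped afterwards.\<close>
  have "(\<Sum>i=k..<n. real (i + 1) powr (- \<gamma> - 1)) \<le> (real k powr - \<gamma> - real n powr - \<gamma>) / \<gamma>"
    using assms(3)
  proof (induction n rule: dec_induct)
    case (step n)
    have n: "real n > 0" using step(1) assms(2) by simp
    have "\<exists>z. real n < z \<and> z < real (n + 1) \<and> real (n + 1) powr - \<gamma> - real n powr - \<gamma>
        = (real (n + 1) - real n) * (- \<gamma> * z powr (- \<gamma> - 1))"
    proof (rule MVT2)
      fix x assume "real n \<le> x" "x \<le> real (n + 1)"
      then show "((\<lambda>x. x powr - \<gamma>) has_real_derivative - \<gamma> * x powr (- \<gamma> - 1)) (at x)"
        using n by (intro has_real_derivative_powr) auto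
    qed simp
    then obtain z where z: "real n < z" "z < real (n + 1)"
      "real n powr - \<gamma> - real (n + 1) powr - \<gamma> = \<gamma> * z powr (- \<gamma> - 1)" by auto
    have "real (n + 1) powr (- \<gamma> - 1) \<le> z powr (- \<gamma> - 1)"
      using z n \<gamma> by (intro powr_mono2') auto
    then have "real (n + 1) powr (- \<gamma> - 1) \<le> (real n powr - \<gamma> - real (n + 1) powr - \<gamma>) / \<gamma>"
      using \<gamma> z(3) by simp
    then show ?case using step by (simp add: diff_divide_distrib)
  qed simp
  also have "\<dots> \<le> real k powr - \<gamma> / \<gamma>" using \<gamma> by (intro divide_right_mono) auto
  finally show ?thesis by (simp add: \<gamma>_def)
qed

definition powr_seq :: "real \<Rightarrow> nat \<Rightarrow> real" where
  "powr_seq \<alpha> i = real (i + 1) powr (- \<alpha>)"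

lemma powr_seq_power2: "(powr_seq \<alpha> i)\<^sup>2 = real (i + 1) powr (- 2 * \<alpha>)"
  unfolding powr_seq_def power2_eq_square by (simp flip: powr_add)

lemma Theta_eq: "Theta n \<alpha> = perm_vec n (powr_seq \<alpha>) ` {\<pi>. \<pi> permutes {..<n}}"
  unfolding Theta_def perm_vec_def powr_seq_def by auto

text \<open>The oracle may depend on the true arrangement, so the subset can consist of the
  positions of the \<open>k\<close> largest values.\<close>

lemma oracle_risk_powr_le:
  assumes "\<sigma> > 0" "\<alpha> > 1/2" "orthonormal n \<phi>" "\<pi> permutes {..<n}" "1 \<le> k" "k \<le> n"
  shows "oracle_risk n \<sigma> \<phi> (f_of n \<phi> (perm_vec n (powr_seq \<alpha>) \<pi>))
     \<le> ennreal (\<sigma>\<^sup>2 * real k / real n + real k powr (1 - 2 * \<alpha>) / (2 * \<alpha> - 1))"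
proof -
  define I where "I = {j. j < n \<and> \<pi> j < k}"
  have inv: "\<pi> (inv \<pi> t) = t" for t by (rule permutes_inverses[OF assms(4)])
  have inv_less: "inv \<pi> t < n \<longleftrightarrow> t < n" for t
    using permutes_in_image[OF permutes_inv[OF assms(4)], of t] by simp
  have less: "\<pi> t < n \<longleftrightarrow> t < n" for t
    using permutes_in_image[OF assms(4), of t] by simp
  have I: "\<pi> ` I = {..<k}"
  proof (intro equalityI subsetI)
    fix t assume "t \<in> {..<k}"
    then show "t \<in> \<pi> ` I" using assms(6) by (intro image_eqI[of _ _ "inv \<pi> t"]) (auto simp: I_def inv inv_less)
  qed (auto simp: I_def)
  have J: "\<pi> ` ({..<n} - I) = {k..<n}"
  proof (intro equalityI subsetI)
    fix t assume "t \<in> {k..<n}"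
    then show "t \<in> \<pi> ` ({..<n} - I)" by (intro image_eqI[of _ _ "inv \<pi> t"]) (auto simp: I_def inv inv_less)
  qed (auto simp: I_def less)
  have inj: "inj_on \<pi> X" for X using permutes_inj[OF assms(4)] by (rule inj_on_subset) simp
  have "card I = k" using card_image[OF inj, of I] I by simp
  moreover have "(\<Sum>j\<in>{..<n} - I. (perm_vec n (powr_seq \<alpha>) \<pi> j)\<^sup>2) = (\<Sum>i=k..<n. (powr_seq \<alpha> i)\<^sup>2)"
    unfolding J[symmetric] by (subst sum.reindex[OF inj]) (simp add: perm_vec_def)
  moreover have "\<dots> \<le> real k powr (1 - 2 * \<alpha>) / (2 * \<alpha> - 1)"
    unfolding powr_seq_power2 using assms by (intro sum_powr_tail_le) auto
  moreover have "I \<subseteq> {..<n}" by (auto simp: I_def)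
  ultimately show ?thesis
    using assms by (intro order_trans[OF oracle_risk_le[where I = I]] ennreal_leI) auto
qed

text \<open>Taking \<open>k\<close> of order \<open>real n powr (1 / (2 * \<alpha>))\<close>
  balances variance and tail. Rounding up at most doubles \<open>x\<close>, as
  \<open>1 \<le> x\<close>, and only helps the tail.\<close>

lemma oracle_risk_powr_rate:
  assumes "\<sigma> > 0" "\<alpha> > 1/2" "orthonormal n \<phi>" "\<pi> permutes {..<n}" "n > 0"
  shows "oracle_risk n \<sigma> \<phi> (f_of n \<phi> (perm_vec n (powr_seq \<alpha>) \<pi>))
     \<le> ennreal ((2 * \<sigma>\<^sup>2 + 1 / (2 * \<alpha> - 1)) * real n powr (1 / (2 * \<alpha>) - 1))"
proof -
  define x where "x = real n powr (1 / (2 * \<alpha>))"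
  define k where "k = nat \<lceil>x\<rceil>"
  have x1: "1 \<le> x" unfolding x_def using assms by (intro ge_one_powr_ge_zero) auto
  have "x \<le> real n powr 1" unfolding x_def using assms by (intro powr_mono) auto
  then have kn: "k \<le> n" unfolding k_def using assms(5) by (simp add: ceiling_le_iff)
  have k: "x \<le> real k" "real k \<le> 2 * x" "1 \<le> k"
    using x1 unfolding k_def by linarith+
  have "\<sigma>\<^sup>2 * real k / real n \<le> \<sigma>\<^sup>2 * (2 * x) / real n"
    using k by (intro divide_right_mono mult_left_mono) auto
  also have "\<dots> = 2 * \<sigma>\<^sup>2 * real n powr (1 / (2 * \<alpha>) - 1)"
    using assms(5) by (simp add: x_def powr_diff)
  finally have 1: "\<sigma>\<^sup>2 * real k / real n \<le> 2 * \<sigma>\<^sup>2 * real n powr (1 / (2 * \<alpha>) - 1)" .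
  have "real k powr (1 - 2 * \<alpha>) \<le> x powr (1 - 2 * \<alpha>)"
    using k x1 assms(2) by (intro powr_mono2') auto
  also have "\<dots> = real n powr (1 / (2 * \<alpha>) - 1)"
    using assms(2) by (simp add: x_def powr_powr field_simps)
  finally have "real k powr (1 - 2 * \<alpha>) / (2 * \<alpha> - 1) \<le> real n powr (1 / (2 * \<alpha>) - 1) / (2 * \<alpha> - 1)"
    using assms(2) by (intro divide_right_mono) auto
  with 1 have "\<sigma>\<^sup>2 * real k / real n + real k powr (1 - 2 * \<alpha>) / (2 * \<alpha> - 1)
     \<le> (2 * \<sigma>\<^sup>2 + 1 / (2 * \<alpha> - 1)) * real n powr (1 / (2 * \<alpha>) - 1)"
    by (simp add: distrib_right)
  then show ?thesis
    using oracle_risk_powr_le[OF assms(1-4) k(3) kn] by (rule order_trans[rotated, OF ennreal_leI])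
qed

text \<open>The needles are the values with indices from \<open>k\<close> to
  \<open>2 * k - 1\<close>. Their signal-to-noise ratio is controlled by \<open>T\<close> alone, so
  a fixed number \<open>L\<close> of hiding places per needle suffices.\<close>

lemma SUP_risk_powr_ge:
  assumes "\<sigma> > 0" "\<alpha> > 1/2" "orthonormal n \<phi>" "fh \<in> estimators n"
    and k: "1 \<le> k" "real n * real k powr (- 2 * \<alpha>) \<le> T"
    and L: "16 * exp (2 * T / \<sigma>\<^sup>2) \<le> real L" "(8 + L) * k \<le> n"
  shows "ennreal (real k * real (2 * k) powr (- 2 * \<alpha>) / 32)
    \<le> (SUP \<theta>\<in>Theta n \<alpha>. risk n \<sigma> fh (f_of n \<phi> \<theta>))"
proof -
  define A where "A = {k..<2 * k}"
  \<comment> \<open>Consecutive intervals of length \<open>L\<close>, the last ending at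
    \<open>8 * k + k * L\<close>, hence below \<open>n\<close>. Starting at \<open>8 * k\<close>
    makes \<open>s + 1\<close> at least \<open>4 * (m + 1)\<close>, so hidden values are at most
    \<open>4 powr - \<alpha>\<close>, hence at most one half, times the needle; here
    \<open>\<alpha> > 1/2\<close> enters.\<close>
  define S where "S m = {8 * k + (m - k) * L..<8 * k + (m - k + 1) * L}" for m
  \<comment> \<open>A quarter of a lower bound for all needles, so \<open>2 * \<delta>\<close> is at
    most half of each needle.\<close>
  define \<delta> where "\<delta> = real (2 * k) powr (- \<alpha>) / 4"
  have n: "n > 0" "8 * k + k * L \<le> n"
    using k(1) L(2) by (auto simp: algebra_simps)
  have "ennreal (real (card A) * (\<delta>\<^sup>2 / 2))
     \<le> (SUP \<pi>\<in>{\<pi>. \<pi> permutes {..<n}}. risk n \<sigma> fh (f_of n \<phi> (perm_vec n (powr_seq \<alpha>) \<pi>)))"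
  proof (rule SUP_risk_ge[where S = S])
    show "A \<subseteq> {..<n}" using n by (auto simp: A_def)
    show "S m \<subseteq> {..<n} - A" if "m \<in> A" for m
    proof -
      have "(m - k + 1) * L \<le> k * L" using that by (intro mult_right_mono) (auto simp: A_def)
      then show ?thesis using n(2) k(1) by (auto simp: S_def A_def)
    qed
    show "disjoint_family_on S A"
    proof -
      have "S a \<inter> S b = {}" if "a < b" "k \<le> a" for a b
      proof -
        have "(a - k + 1) * L \<le> (b - k) * L" using that by (intro mult_right_mono) auto
        then show ?thesis by (auto simp: S_def)
      qed
      then show ?thesis
        unfolding disjoint_family_on_def A_def
        by (metis Int_commute atLeastLessThan_iff linorder_neqE_nat)
    qed
    show "powr_seq \<alpha> s \<le> powr_seq \<alpha> m - 2 * \<delta>" if m: "m \<in> A" and s: "s \<in> S m" for m s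
    proof -
      have "real (s + 1) powr - \<alpha> \<le> (4 * real (m + 1)) powr - \<alpha>"
        using m s assms(2) by (intro powr_mono2') (auto simp: S_def A_def)
      also have "\<dots> = 4 powr - \<alpha> * real (m + 1) powr - \<alpha>" by (intro powr_mult)
      also have "4 powr - \<alpha> \<le> (4::real) powr - (1/2)"
        using assms(2) by (intro powr_mono) auto
      also have "(4::real) powr - (1/2) = 1/2" by (simp add: powr_minus powr_half_sqrt)
      finally have "powr_seq \<alpha> s \<le> powr_seq \<alpha> m / 2" by (simp add: powr_seq_def mult_right_mono)
      moreover have "real (2 * k) powr - \<alpha> \<le> powr_seq \<alpha> m"
        unfolding powr_seq_def using m assms(2) by (intro powr_mono2') (auto simp: A_def)
      ultimately show ?thesis by (simp add: \<delta>_def)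
    qed
    show "16 * exp (2 * real n * (powr_seq \<alpha> m)\<^sup>2 / \<sigma>\<^sup>2) \<le> real (card (S m))" if m: "m \<in> A" for m
    proof -
      have "real (m + 1) powr (- 2 * \<alpha>) \<le> real k powr (- 2 * \<alpha>)"
        using m k(1) assms(2) by (intro powr_mono2') (auto simp: A_def)
      then have "real n * (powr_seq \<alpha> m)\<^sup>2 \<le> real n * real k powr (- 2 * \<alpha>)"
        unfolding powr_seq_power2 by (intro mult_left_mono) auto
      also have "\<dots> \<le> T" by (rule k(2))
      finally have "16 * exp (2 * real n * (powr_seq \<alpha> m)\<^sup>2 / \<sigma>\<^sup>2) \<le> 16 * exp (2 * T / \<sigma>\<^sup>2)"
        by (simp add: divide_right_mono)
      also have "\<dots> \<le> real (card (S m))" using L(1) by (simp add: S_def)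
      finally show ?thesis .
    qed
  qed (use assms n in \<open>auto simp: \<delta>_def powr_seq_def\<close>)
  also have "real (card A) * (\<delta>\<^sup>2 / 2) = real k * real (2 * k) powr (- 2 * \<alpha>) / 32"
    unfolding \<delta>_def A_def power_divide
    by (simp add: power2_eq_square flip: powr_add)
  finally show ?thesis by (simp add: Theta_eq image_image)
qed

text \<open>Same power of \<open>n\<close> as in the oracle bound, but with a factor that grows with
  \<open>T\<close>. The lower bound imposed on \<open>n\<close> through \<open>L\<close> provides
  room for all hiding places.\<close>

lemma SUP_risk_powr_rate:
  assumes "\<sigma> > 0" "\<alpha> > 1/2" "orthonormal n \<phi>" "fh \<in> estimators n"
    and T: "1 \<le> T" "T \<le> real n"
    and L: "16 * exp (2 * T / \<sigma>\<^sup>2) \<le> real L"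
      "2 * (8 + real L) \<le> real n powr (1 - 1 / (2 * \<alpha>))"
  shows "ennreal (2 powr (- 4 * \<alpha>) / 16 * T powr (1 - 1 / (2 * \<alpha>)) * real n powr (1 / (2 * \<alpha>) - 1))
    \<le> (SUP \<theta>\<in>Theta n \<alpha>. risk n \<sigma> fh (f_of n \<phi> \<theta>))"
proof -
  define x where "x = (real n / T) powr (1 / (2 * \<alpha>))"
  \<comment> \<open>The least integer with
    \<open>real n * real k powr (- 2 * \<alpha>) \<le> T\<close>; it exceeds \<open>x\<close> by a
    factor of at most 2, because \<open>T \<le> real n\<close> gives
    \<open>1 \<le> x\<close>.\<close>
  define k where "k = nat \<lceil>x\<rceil>"
  have x1: "1 \<le> x" unfolding x_def using assms by (intro ge_one_powr_ge_zero) auto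
  have k: "x \<le> real k" "real k \<le> 2 * x" "1 \<le> k"
    using x1 unfolding k_def by linarith+
  have "real k powr (- 2 * \<alpha>) \<le> x powr (- 2 * \<alpha>)"
    using k x1 assms(2) by (intro powr_mono2') auto
  also have "\<dots> = T / real n"
    using assms(2) T by (simp add: x_def powr_powr powr_minus_divide)
  finally have k': "real n * real k powr (- 2 * \<alpha>) \<le> T"
    using T by (simp add: field_simps)
  have "x \<le> real n powr (1 / (2 * \<alpha>))"
    unfolding x_def using T assms(2) by (intro powr_mono2) (auto simp: field_simps mult_le_cancel_left1)
  then have "(8 + real L) * real k \<le> (8 + real L) * (2 * real n powr (1 / (2 * \<alpha>)))"
    using k by (intro mult_left_mono) auto
  also have "\<dots> \<le> real n powr (1 - 1 / (2 * \<alpha>)) * real n powr (1 / (2 * \<alpha>))"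
    using mult_right_mono[OF L(2), of "real n powr (1 / (2 * \<alpha>))", OF powr_ge_zero]
    by (simp only: ac_simps)
  also have "\<dots> = real n" using T by (simp flip: powr_add)
  finally have "real ((8 + L) * k) \<le> real n" by simp
  then have kn: "(8 + L) * k \<le> n" by (simp only: of_nat_le_iff)
  \<comment> \<open>The constant collects \<open>2 powr (- 2 * \<alpha>)\<close> from the smallest
    needle, \<open>2 powr (1 - 2 * \<alpha>)\<close> from \<open>real k \<le> 2 * x\<close>, and the
    factor \<open>1 / 32\<close>.\<close>
  have "2 powr (- 4 * \<alpha>) / 16 * T powr (1 - 1 / (2 * \<alpha>)) * real n powr (1 / (2 * \<alpha>) - 1)
      = 2 powr (- 2 * \<alpha>) * (2 * x) powr (1 - 2 * \<alpha>) / 32"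
  proof -
    have "(2 * x) powr (1 - 2 * \<alpha>) = 2 powr (1 - 2 * \<alpha>) * (real n / T) powr (1 / (2 * \<alpha>) - 1)"
      using x1 assms(2) by (simp add: powr_mult x_def powr_powr field_simps)
    also have "2 powr (1 - 2 * \<alpha>) = 2 * 2 powr (- 2 * \<alpha>)"
      by (simp add: powr_diff powr_minus_divide)
    also have "(real n / T) powr (1 / (2 * \<alpha>) - 1) = real n powr (1 / (2 * \<alpha>) - 1) * T powr (1 - 1 / (2 * \<alpha>))"
      using T by (simp add: powr_divide powr_diff)
    finally show ?thesis
      by (simp add: field_simps flip: powr_add)
  qed
  also have "\<dots> \<le> 2 powr (- 2 * \<alpha>) * real k powr (1 - 2 * \<alpha>) / 32"
    using k x1 assms(2) by (intro divide_right_mono mult_left_mono powr_mono2') auto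
  also have "\<dots> = real k * real (2 * k) powr (- 2 * \<alpha>) / 32"
    using k(3) by (simp add: powr_mult powr_diff powr_minus_divide)
  finally show ?thesis
    by (rule order_trans[OF ennreal_leI SUP_risk_powr_ge[OF assms(1-4) k(3) k' L(1) kn]])
qed

section \<open>Comparison of the two rates and passage to the limit\<close>

theorem theorem7:
  fixes \<sigma> \<alpha> :: real and \<phi> :: "nat \<Rightarrow> nat \<Rightarrow> nat \<Rightarrow> real"
  assumes "\<sigma> > 0"
    and "\<alpha> > 1/2"
    and "\<And>n j k. j < n \<Longrightarrow> k < n \<Longrightarrow>
           (\<Sum>i<n. \<phi> n j i * \<phi> n k i) = (if j = k then 1 else 0)"
  shows "((\<lambda>n. INF fh\<in>estimators n. SUP \<theta>\<in>Theta n \<alpha>.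
            risk n \<sigma> fh (f_of n (\<phi> n) \<theta>) / oracle_risk n \<sigma> (\<phi> n) (f_of n (\<phi> n) \<theta>))
          \<longlongrightarrow> \<infinity>) sequentially"
proof -
  have \<phi>: "orthonormal n (\<phi> n)" for n using assms(3) by (simp add: orthonormal_def)
  define \<beta> where "\<beta> = 1 - 1 / (2 * \<alpha>)"
  have \<beta>: "\<beta> > 0" using assms(2) by (simp add: \<beta>_def field_simps)
  define D where "D = 2 * \<sigma>\<^sup>2 + 1 / (2 * \<alpha> - 1)"
  have D: "D > 0" using assms(1,2) by (auto simp: D_def intro!: add_pos_pos)
  define c where "c = 2 powr (- 4 * \<alpha>) / 16"
  have c: "c > 0" by (simp add: c_def)
  have powr_ge: "y \<le> z powr \<beta>" if "0 \<le> y" "y powr (1 / \<beta>) \<le> z" for y z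
  proof -
    have "y = (y powr (1 / \<beta>)) powr \<beta>" using that \<beta> by (simp add: powr_powr)
    also have "\<dots> \<le> z powr \<beta>" using that \<beta> by (intro powr_mono2) auto
    finally show ?thesis .
  qed
  have main: "\<forall>\<^sub>F n in sequentially. ennreal M \<le> (INF fh\<in>estimators n. SUP \<theta>\<in>Theta n \<alpha>.
            risk n \<sigma> fh (f_of n (\<phi> n) \<theta>) / oracle_risk n \<sigma> (\<phi> n) (f_of n (\<phi> n) \<theta>))"
    if M: "M \<ge> 0" for M
  proof -
    \<comment> \<open>Order of choices: \<open>T\<close> depends on \<open>M\<close> and makes the
      lower bound exceed \<open>M\<close> times the oracle bound, \<open>L\<close> depends on
      \<open>T\<close>, and only then is \<open>n\<close> taken large.\<close>
    define T where "T = max 1 ((M * D / c) powr (1 / \<beta>))"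
    have T: "1 \<le> T" "M * D \<le> c * T powr \<beta>"
      using powr_ge[of "M * D / c" T] M D c by (auto simp: T_def field_simps)
    define L where "L = nat \<lceil>16 * exp (2 * T / \<sigma>\<^sup>2)\<rceil>"
    have L: "16 * exp (2 * T / \<sigma>\<^sup>2) \<le> real L" unfolding L_def by linarith
    have "\<forall>\<^sub>F n in sequentially. max T ((2 * (8 + real L)) powr (1 / \<beta>)) \<le> real n"
      using filterlim_real_sequentially unfolding filterlim_at_top by blast
    then show ?thesis
    proof eventually_elim
      case (elim n)
      have n: "T \<le> real n" "2 * (8 + real L) \<le> real n powr (1 - 1 / (2 * \<alpha>))"
        using elim powr_ge[of "2 * (8 + real L)" "real n"] by (auto simp: \<beta>_def)
      then have n0: "n > 0" using T(1) by (cases n) auto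
      define r where "r = D * real n powr (1 / (2 * \<alpha>) - 1)"
      have r: "r > 0" using D n0 by (simp add: r_def)
      show ?case
      \<comment> \<open>The threshold for \<open>n\<close> was fixed before the estimator, so the
        bound is uniform and passes to the infimum.\<close>
      proof (intro INF_greatest)
        fix fh assume fh: "fh \<in> estimators n"
        have "M * r \<le> c * T powr (1 - 1 / (2 * \<alpha>)) * real n powr (1 / (2 * \<alpha>) - 1)"
          using mult_right_mono[OF T(2), of "real n powr (1 / (2 * \<alpha>) - 1)"]
          by (simp add: r_def \<beta>_def mult.assoc)
        then have *: "ennreal (M * r) \<le> (SUP \<theta>\<in>Theta n \<alpha>. risk n \<sigma> fh (f_of n (\<phi> n) \<theta>))"
          unfolding c_def
          by (rule order_trans[OF ennreal_leI SUP_risk_powr_rate[OF assms(1,2) \<phi> fh T(1) n(1) L n(2)]])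
        have "ennreal M = ennreal (M * r) / ennreal r"
          using M r by (simp add: divide_ennreal)
        also have "\<dots> \<le> (SUP \<theta>\<in>Theta n \<alpha>. risk n \<sigma> fh (f_of n (\<phi> n) \<theta>)) / ennreal r"
          by (rule divide_right_mono_ennreal[OF *])
        \<comment> \<open>The oracle bound \<open>r\<close> is the same for all arrangements, so it
          can be moved inside the supremum before it is replaced by the oracle risk.\<close>
        also have "\<dots> = (SUP \<theta>\<in>Theta n \<alpha>. risk n \<sigma> fh (f_of n (\<phi> n) \<theta>) / ennreal r)"
          by (rule SUP_divide_ennreal)
        also have "\<dots> \<le> (SUP \<theta>\<in>Theta n \<alpha>.
            risk n \<sigma> fh (f_of n (\<phi> n) \<theta>) / oracle_risk n \<sigma> (\<phi> n) (f_of n (\<phi> n) \<theta>))"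
        proof (rule SUP_mono, rule bexI)
          fix \<theta> assume \<theta>: "\<theta> \<in> Theta n \<alpha>"
          then show "\<theta> \<in> Theta n \<alpha>" .
          have "oracle_risk n \<sigma> (\<phi> n) (f_of n (\<phi> n) \<theta>) \<le> ennreal r"
            using \<theta> oracle_risk_powr_rate[OF assms(1,2) \<phi> _ n0]
            unfolding r_def D_def by (auto simp: Theta_eq)
          then show "risk n \<sigma> fh (f_of n (\<phi> n) \<theta>) / ennreal r
            \<le> risk n \<sigma> fh (f_of n (\<phi> n) \<theta>) / oracle_risk n \<sigma> (\<phi> n) (f_of n (\<phi> n) \<theta>)"
            by (rule divide_left_mono_ennreal)
        qed
        finally show "ennreal M \<le> (SUP \<theta>\<in>Theta n \<alpha>.
            risk n \<sigma> fh (f_of n (\<phi> n) \<theta>) / oracle_risk n \<sigma> (\<phi> n) (f_of n (\<phi> n) \<theta>))" .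
      qed
    qed
  qed
  show ?thesis
  proof (rule order_tendstoI)
    fix a :: ennreal assume a: "a < \<infinity>"
    then obtain M where M: "M \<ge> 0" "a = ennreal M" by (cases a) auto
    \<comment> \<open>Using \<open>M + 1\<close> turns the weak eventual bound into the strict one
      that \<open>order_tendstoI\<close> asks for.\<close>
    have "a < ennreal (M + 1)" using M by (simp add: ennreal_lessI)
    moreover have "\<forall>\<^sub>F n in sequentially. ennreal (M + 1) \<le> (INF fh\<in>estimators n. SUP \<theta>\<in>Theta n \<alpha>.
            risk n \<sigma> fh (f_of n (\<phi> n) \<theta>) / oracle_risk n \<sigma> (\<phi> n) (f_of n (\<phi> n) \<theta>))"
      using M(1) by (intro main) simp
    ultimately show "\<forall>\<^sub>F n in sequentially. a < (INF fh\<in>estimators n. SUP \<theta>\<in>Theta n \<alpha>.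
            risk n \<sigma> fh (f_of n (\<phi> n) \<theta>) / oracle_risk n \<sigma> (\<phi> n) (f_of n (\<phi> n) \<theta>))"
      by (auto elim!: eventually_mono intro: less_le_trans simp del: ennreal_plus)
  qed simp
qed

end
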